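(* Let $\rho>0$, let $(\tau_j)_{j\ge1}$ be i.i.d. exponentially distributed with mean $1/\rho$, and let $(t_j)_{j\ge1}$ be i.i.d. real random variables, independent of the $\tau_j$, with characteristic function $\chi(\theta)=\mathbb{E}(e^{\mathrm{i}\theta t_j})$. Let $$g_j=\begin{pmatrix}\cos\frac{t_j}{2}&-\sin\frac{t_j}{2}\\ \sin\frac{t_j}{2}&\cos\frac{t_j}{2}\end{pmatrix}\begin{pmatrix}1&\tau_j\\0&1\end{pmatrix},\qquad \Pi_n=g_n\cdots g_2g_1 ,$$ and let $\gamma$ and $\sigma^2$ be the growth rate and variance of the product. Assume the standing assumptions listed in the context, and let $f_0$ be the square-summable sequence described there. Then $$\gamma=-\frac{\lambda_1}{2},\qquad \sigma^2=\frac{\lambda_1^2}{4}-\frac{\lambda_2}{2},$$ where $$\lambda_1=\frac1\rho\,\operatorname{Im} f_0(1),\qquad \lambda_2=\frac1\rho\,\operatorname{Im} f_1(1),$$ $$f_1(1)=f_0(1)+2\mathrm{i}\rho\,\lambda_1\sum_{n=1}^\infty\frac{\chi(n)}{n}f_0(n)^2-\sum_{n=1}^\infty\frac{1}{n(n+1)}f_0(n)f_0(n+1).$$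
   Context: The group $\mathrm{SL}(2,\mathbb{R})$ acts on nonzero row vectors by right multiplication $\mathbf{x}\mapsto\mathbf{x}g$. The generalised Lyapunov exponent is $\Lambda(2\ell)=\lim_{n\to\infty}\frac1n\ln\mathbb{E}(|\mathbf{x}\Pi_n|^{2\ell})$ (independent of $\mathbf{x}\ne\mathbf{0}$ and of the norm), and $\gamma=\Lambda'(0)$, $\sigma^2=\Lambda''(0)$. Action on the circle: $\theta\in[0,2\pi)$ stands for the line spanned by $(\cos\frac\theta2,\sin\frac\theta2)$, and $\theta\cdot g$ is the parameter of the line spanned by $(\cos\frac\theta2,\sin\frac\theta2)g$. A probability measure $\nu$ on the circle is invariant if $\int\mathbb{E}[\varphi(\theta\cdot g_1)]\,\nu(d\theta)=\int\varphi\,d\nu$ for all continuous $\varphi$. Standing assumptions. (i) For real $\ell$ near $0$ the limit $\Lambda(2\ell)$ exists and $\lambda(\ell):=\exp[-\Lambda(2\ell)]$ has a convergent expansion $\lambda(\ell)=1+\lambda_1\ell+\lambda_2\ell^2+\cdots$. (ii) There is a unique invariant probability measure $\nu$ on the circle; its Fourier coefficients $f_0(n)=\int e^{-\mathrm{i}n\theta}\nu(d\theta)$, $n\in\mathbb{Z}$, form a square-summable sequence, which is the unique square-summable solution, with $f_0(0)=1$ and $f_0(n)\to0$ as $|n|\to\infty$, of the Dyson--Schmidt equation $$f_0(n)+\frac{\mathrm{i}n}{2\rho}\left[f_0(n+1)+2f_0(n)+f_0(n-1)\right]=\chi(n)f_0(n),\qquad n\in\mathbb{Z}.$$ *)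

theory Defs
  imports "HOL-Probability.Probability"
begin

section \<open>The random matrix product\<close>

definition rotation_shear :: "real \<Rightarrow> real \<Rightarrow> real^2^2" where
  "rotation_shear t s =
     (vector [vector [cos (t/2), - sin (t/2)], vector [sin (t/2), cos (t/2)]] :: real^2^2) **
     (vector [vector [1, s], vector [0, 1]] :: real^2^2)"

primrec matprod :: "(nat \<Rightarrow> real^2^2) \<Rightarrow> nat \<Rightarrow> real^2^2" where
  "matprod g 0 = mat 1"
| "matprod g (Suc n) = g (Suc n) ** matprod g n"

text \<open>The argument \<open>q\<close> is the full exponent of the norm, i.e. \<open>q = 2\<ell>\<close>. Vectors are row
  vectors, acted on from the right by \<open>v*\<close>; the limit is required to be the same for all
  nonzero \<open>x\<close>.\<close>

definition has_lyapunov_exponent ::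
  "'a measure \<Rightarrow> (nat \<Rightarrow> 'a \<Rightarrow> real^2^2) \<Rightarrow> real \<Rightarrow> real \<Rightarrow> bool" where
  "has_lyapunov_exponent M g q L \<longleftrightarrow>
     (\<forall>x::real^2. x \<noteq> 0 \<longrightarrow>
        (\<lambda>n. 1 / real n * ln (\<integral>\<omega>. norm (x v* matprod (\<lambda>j. g j \<omega>) n) powr q \<partial>M)) \<longlonglongrightarrow> L)"

definition gen_lyapunov :: "'a measure \<Rightarrow> (nat \<Rightarrow> 'a \<Rightarrow> real^2^2) \<Rightarrow> real \<Rightarrow> real" where
  "gen_lyapunov M g q = (THE L. has_lyapunov_exponent M g q L)"

definition growth_rate :: "'a measure \<Rightarrow> (nat \<Rightarrow> 'a \<Rightarrow> real^2^2) \<Rightarrow> real" where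
  "growth_rate M g = deriv (gen_lyapunov M g) 0"

definition growth_variance :: "'a measure \<Rightarrow> (nat \<Rightarrow> 'a \<Rightarrow> real^2^2) \<Rightarrow> real" where
  "growth_variance M g = deriv (deriv (gen_lyapunov M g)) 0"

section \<open>The action on the circle of lines\<close>

definition half_angle_vec :: "real \<Rightarrow> real^2" where
  "half_angle_vec \<theta> = vector [cos (\<theta>/2), sin (\<theta>/2)]"

definition circle_act :: "real \<Rightarrow> real^2^2 \<Rightarrow> real" where
  "circle_act \<theta> A = (THE \<phi>. \<phi> \<in> {0..<2*pi} \<and> span {half_angle_vec \<phi>} = span {half_angle_vec \<theta> v* A})"

text \<open>The circle is represented by the fundamental domain \<open>[0,2\<pi>)\<close> with its Borel sets;
  accordingly, continuous functions on the circle are continuous \<open>2\<pi>\<close>-periodic functions on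
  the line (not arbitrary continuous functions on the half-open interval).\<close>

definition circle_prob :: "real measure \<Rightarrow> bool" where
  "circle_prob \<nu> \<longleftrightarrow> prob_space \<nu> \<and> sets \<nu> = sets (restrict_space borel {0..<2*pi})"

definition circle_invariant :: "'a measure \<Rightarrow> ('a \<Rightarrow> real^2^2) \<Rightarrow> real measure \<Rightarrow> bool" where
  "circle_invariant M A \<nu> \<longleftrightarrow>
     (\<forall>\<phi>::real \<Rightarrow> real. continuous_on UNIV \<phi> \<and> (\<forall>\<theta>. \<phi> (\<theta> + 2*pi) = \<phi> \<theta>) \<longrightarrow>
        (\<integral>\<theta>. (\<integral>\<omega>. \<phi> (circle_act \<theta> (A \<omega>)) \<partial>M) \<partial>\<nu>) = (\<integral>\<theta>. \<phi> \<theta> \<partial>\<nu>))"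

definition circle_fourier :: "real measure \<Rightarrow> int \<Rightarrow> complex" where
  "circle_fourier \<nu> n = (\<integral>\<theta>. exp (- (\<i> * of_int n * complex_of_real \<theta>)) \<partial>\<nu>)"

section \<open>The Dyson--Schmidt equation\<close>

definition dyson_schmidt :: "real \<Rightarrow> (real \<Rightarrow> complex) \<Rightarrow> (int \<Rightarrow> complex) \<Rightarrow> bool" where
  "dyson_schmidt \<rho> ch f \<longleftrightarrow>
     (\<forall>n. f n + \<i> * of_int n / (2 * complex_of_real \<rho>) * (f (n + 1) + 2 * f n + f (n - 1))
            = ch (of_int n) * f n)"

text \<open>On the integers, convergence along \<open>cofinite\<close> is convergence as \<open>\<bar>n\<bar> \<rightarrow> \<infinity>\<close>.\<close>

definition dyson_schmidt_solution :: "real \<Rightarrow> (real \<Rightarrow> complex) \<Rightarrow> (int \<Rightarrow> complex) \<Rightarrow> bool" where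
  "dyson_schmidt_solution \<rho> ch f \<longleftrightarrow>
     (\<lambda>n. (cmod (f n))\<^sup>2) summable_on UNIV \<and> f 0 = 1 \<and> (f \<longlongrightarrow> 0) cofinite \<and> dyson_schmidt \<rho> ch f"

end

theory Submission
  imports Defs "HOL-Real_Asymp.Real_Asymp"
begin

text \<open>Identify a row vector with a complex number \<open>z\<close> and put
  \<open>e\<^sub>k z = \<bar>z\<bar>\<^sup>2\<^sup>l (cnj z / z)\<^sup>k\<close>. Since the exponential average of the shear flow is a
  resolvent, the transfer operator sends \<open>(1 - D/\<rho>) e\<^sub>k\<close> to \<open>\<chi>(k) e\<^sub>k\<close>, \<open>D\<close> being the generator of the
  flow. For \<open>r\<close> slightly below \<open>exp (- \<Lambda>(2l))\<close> the normalised sums over \<open>n\<close> of \<open>r\<^sup>n\<close> times the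
  expectation of \<open>e\<^sub>k\<close> along the walk are therefore bounded by 1 and solve a Dyson--Schmidt equation
  with parameter \<open>l\<close> up to an error that vanishes as \<open>r\<close> increases to \<open>exp (- \<Lambda>(2l))\<close>, because the
  moments are submultiplicative, so that the normalising series diverges there. The equation at
  \<open>k = 0\<close> expresses \<open>r\<close> through the coefficient \<open>f 1\<close>. Summing the Wronskian of this solution with \<open>f0\<close>
  gives \<open>f 1 - f0 1\<close> exactly as a series with absolutely summable weights \<open>f0 n / n\<close>; hence
  \<open>f \<longlongrightarrow> f0\<close> pointwise as \<open>l\<close> tends to 0, and dividing by \<open>l\<close> yields the first-order correction.
  No compactness or spectral gap is needed.\<close>

section \<open>Shears, rotations and angular harmonics\<close>

definition shear :: "real \<Rightarrow> complex \<Rightarrow> complex" where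
  "shear s w = w + \<i> * complex_of_real (s * Re w)"

text \<open>A row vector (x, y) is read as x + i y. Right multiplication by the rotation becomes
  multiplication by \<open>cis (- t / 2)\<close>, and by the unipotent factor it becomes
  \<open>shear s\<close>; the rotation stands on the left in the product, so it acts first.\<close>

definition step :: "real \<times> real \<Rightarrow> complex \<Rightarrow> complex" where
  "step p z = shear (snd p) (cis (- fst p / 2) * z)"

text \<open>For nonzero z let \<theta> be twice its argument, the circle parameter of the line
  through z. Then \<open>cnj z / z\<close> is e^(-i\<theta>), so these are the Fourier modes
  e^(-ik\<theta>) extended to the plane with homogeneity q.\<close>

definition harmonic :: "real \<Rightarrow> int \<Rightarrow> complex \<Rightarrow> complex" where
  "harmonic q k z = complex_of_real (cmod z powr q) * (cnj z / z) powi k"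

lemma shear_0 [simp]: "shear s 0 = 0"
  by (simp add: shear_def)

lemma shear_eq_0_iff [simp]: "shear s w = 0 \<longleftrightarrow> w = 0"
  by (auto simp: shear_def complex_eq_iff)

lemma step_eq_0_iff [simp]: "step p z = 0 \<longleftrightarrow> z = 0"
  by (simp add: step_def cis_neq_zero)

lemma step_linear:
  "step p (of_real a * z + of_real b * w) = of_real a * step p z + of_real b * step p w"
  by (simp add: step_def shear_def complex_eq_iff algebra_simps)

lemma norm_shear_le: "cmod (shear s w) \<le> (1 + \<bar>s\<bar>) * cmod w"
proof -
  have "cmod (shear s w) \<le> cmod w + \<bar>s\<bar> * \<bar>Re w\<bar>"
    unfolding shear_def by (rule norm_triangle_le) (simp add: norm_mult abs_mult)
  also have "\<bar>s\<bar> * \<bar>Re w\<bar> \<le> \<bar>s\<bar> * cmod w"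
    by (intro mult_left_mono abs_Re_le_cmod) auto
  finally show ?thesis by (simp add: algebra_simps)
qed

text \<open>For exponents up to 1 the stretching factor is at most linear in s, so the first moment
  of the exponential law dominates every integrand below.\<close>

lemma shear_powr_le:
  assumes "0 < q" "q \<le> 1"
  shows "cmod (shear s w) powr q \<le> (1 + \<bar>s\<bar>) * cmod w powr q"
proof -
  have "cmod (shear s w) powr q \<le> ((1 + \<bar>s\<bar>) * cmod w) powr q"
    using assms by (intro powr_mono2 norm_shear_le) auto
  also have "\<dots> = (1 + \<bar>s\<bar>) powr q * cmod w powr q"
    by (simp add: powr_mult)
  also have "(1 + \<bar>s\<bar>) powr q \<le> (1 + \<bar>s\<bar>) powr 1"
    using assms by (intro powr_mono) auto
  finally show ?thesis by (simp add: mult_right_mono)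
qed

lemma step_powr_le:
  assumes "0 < q" "q \<le> 1"
  shows "cmod (step p z) powr q \<le> (1 + \<bar>snd p\<bar>) * cmod z powr q"
  using shear_powr_le[OF assms, of "snd p" "cis (- fst p / 2) * z"]
  by (simp add: step_def norm_mult)

lemma measurable_shear [measurable]:
  assumes [measurable]: "f \<in> borel_measurable N" "h \<in> borel_measurable N"
  shows "(\<lambda>x. shear (f x) (h x)) \<in> borel_measurable N"
  unfolding shear_def by measurable

lemma borel_measurable_cis [measurable]: "cis \<in> borel_measurable borel"
  by (intro borel_measurable_continuous_onI) (simp add: cis_conv_exp continuous_intros)

lemma measurable_step [measurable]:
  assumes [measurable]: "f \<in> N \<rightarrow>\<^sub>M borel \<Otimes>\<^sub>M borel" "h \<in> borel_measurable N"
  shows "(\<lambda>x. step (f x) (h x)) \<in> borel_measurable N"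
  unfolding step_def by measurable

lemma borel_measurable_harmonic [measurable]: "harmonic q k \<in> borel_measurable borel"
proof -
  have [measurable]: "cnj \<in> borel_measurable borel"
    by (intro borel_measurable_continuous_onI continuous_intros)
  show ?thesis
    unfolding harmonic_def power_int_def by (cases "k \<ge> 0"; simp; measurable)
qed

lemma harmonic_0 [simp]: "harmonic q k 0 = 0"
  by (simp add: harmonic_def)

lemma harmonic_zero: "harmonic q 0 z = complex_of_real (cmod z powr q)"
  by (simp add: harmonic_def)

lemma norm_harmonic [simp]: "cmod (harmonic q k z) = cmod z powr q"
  by (cases "z = 0") (auto simp: harmonic_def norm_mult norm_power_int norm_divide)

lemma cnj_harmonic: "cnj (harmonic q k z) = harmonic q (- k) z"
  by (cases "z = 0") (auto simp: harmonic_def power_int_minus power_int_divide_distrib field_simps)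

text \<open>Rotations act diagonally on the harmonics. Averaging the eigenvalue over the law of the
  angle is what produces \<chi>(k).\<close>

lemma harmonic_rotate: "harmonic q k (cis (- t / 2) * z) = cis (t * real_of_int k) * harmonic q k z"
proof -
  have "cis (t / 2) / cis (- t / 2) = cis t"
    by (simp add: cis_divide)
  then have quot: "cnj (cis (- t / 2) * z) / (cis (- t / 2) * z) = cis t * (cnj z / z)"
    by (simp add: cis_cnj flip: times_divide_times_eq)
  have "harmonic q k (cis (- t / 2) * z) = of_real (cmod z powr q) * (cis t * (cnj z / z)) powi k"
    unfolding harmonic_def quot by (simp add: norm_mult)
  also have "\<dots> = cis (t * real_of_int k) * harmonic q k z"
    unfolding harmonic_def power_int_mult_distrib cis_power_int by (simp add: mult.commute)
  finally show ?thesis .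
qed

section \<open>Generator of the shear flow on harmonics\<close>

definition flow_deriv :: "real \<Rightarrow> int \<Rightarrow> complex \<Rightarrow> complex" where
  "flow_deriv l k z = \<i> / 2 * ((of_real l - of_int k) * harmonic (2*l) (k + 1) z
     - 2 * of_int k * harmonic (2*l) k z - (of_real l + of_int k) * harmonic (2*l) (k - 1) z)"

lemma borel_measurable_flow_deriv [measurable]: "flow_deriv l k \<in> borel_measurable borel"
  unfolding flow_deriv_def by measurable

lemma flow_deriv_0 [simp]: "flow_deriv l k 0 = 0"
  by (simp add: flow_deriv_def)

lemma norm_flow_deriv_le:
  "cmod (flow_deriv l k z) \<le> (\<bar>l\<bar> + 2 * \<bar>of_int k\<bar>) * cmod z powr (2*l)"
proof -
  have "cmod (flow_deriv l k z) \<le> 1 / 2 * (cmod (of_real l - of_int k) * cmod z powr (2*l)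
     + 2 * \<bar>of_int k\<bar> * cmod z powr (2*l) + cmod (of_real l + of_int k) * cmod z powr (2*l))"
    unfolding flow_deriv_def
    by (simp only: norm_mult norm_divide norm_ii)
       (intro mult_mono order_trans[OF norm_triangle_ineq4] add_mono; simp add: norm_mult)
  also have "\<dots> = 1/2 * (cmod (of_real l - of_int k) + 2 * \<bar>of_int k\<bar> + cmod (of_real l + of_int k))
     * cmod z powr (2*l)"
    by (simp add: algebra_simps)
  also have "\<dots> \<le> 1/2 * ((\<bar>l\<bar> + \<bar>of_int k\<bar>) + 2 * \<bar>of_int k\<bar> + (\<bar>l\<bar> + \<bar>of_int k\<bar>)) * cmod z powr (2*l)"
    by (intro mult_right_mono mult_left_mono add_mono
          order_trans[OF norm_triangle_ineq4] order_trans[OF norm_triangle_ineq]) auto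
  finally show ?thesis by (simp add: algebra_simps)
qed

text \<open>Along the flow the phase v = cnj u / u moves with velocity -(i/2)(1 + v)^2 and ln |u|
  with velocity (1/v - v)/(4i). The generator therefore couples mode k to k - 1, k and k + 1 only,
  which is the source of the three-term recurrence.\<close>

lemma harmonic_flow_deriv:
  assumes "w \<noteq> 0"
  shows "((\<lambda>s. harmonic (2*l) k (shear s w)) has_vector_derivative flow_deriv l k (shear s w)) (at s)"
proof -
  define u where "u = shear s w"
  define a where "a = Re w"
  have u0: "u \<noteq> 0" using assms by (simp add: u_def)
  have Reu: "Re u = a" by (simp add: u_def shear_def a_def)
  have D_shear: "((\<lambda>s. shear s w) has_vector_derivative (\<i> * of_real a)) (at s)"
    unfolding shear_def a_def by (auto intro!: derivative_eq_intros)
  have D_cnj: "((\<lambda>s. cnj (shear s w)) has_vector_derivative (- \<i> * of_real a)) (at s)"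
    using has_vector_derivative_cnj[OF D_shear] by simp
  have sq: "(cmod (shear x w))\<^sup>2 = a\<^sup>2 + (Im w + x * a)\<^sup>2" for x
    by (simp add: cmod_power2 shear_def a_def)
  have pos: "0 < a\<^sup>2 + (Im w + s * a)\<^sup>2"
    using u0 by (simp flip: sq add: u_def)
  have powr_sq: "cmod (shear x w) powr (2*l) = (a\<^sup>2 + (Im w + x * a)\<^sup>2) powr l" for x
    by (simp flip: sq add: powr_powr flip: powr_numeral)
  have Imu: "Im u = Im w + s * a" by (simp add: u_def shear_def a_def)
  have "((\<lambda>x. (a\<^sup>2 + (Im w + x * a)\<^sup>2) powr l) has_real_derivative
      l * (a\<^sup>2 + (Im w + s * a)\<^sup>2) powr (l - 1) * (2 * (Im w + s * a) * a)) (at s)"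
    using pos by (auto intro!: derivative_eq_intros)
  moreover have "(a\<^sup>2 + (Im w + s * a)\<^sup>2) powr (l - 1) = cmod u powr (2*l) / (cmod u)\<^sup>2"
    using pos by (simp add: powr_diff u_def sq powr_sq)
  ultimately have "((\<lambda>x. cmod (shear x w) powr (2*l)) has_real_derivative
      2 * l * cmod u powr (2*l) * Im u * a / (cmod u)\<^sup>2) (at s)"
    unfolding powr_sq Imu[symmetric] by (simp add: field_simps)
  then have D_pow: "((\<lambda>x. complex_of_real (cmod (shear x w) powr (2*l))) has_vector_derivative
      of_real (2 * l * cmod u powr (2*l) * Im u * a / (cmod u)\<^sup>2)) (at s)"
    by (rule has_vector_derivative_of_real)
  have D_inv: "((\<lambda>x. inverse (shear x w)) has_vector_derivative (\<i> * of_real a) * (- inverse (u^2))) (at s)"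
    using field_vector_diff_chain_at[OF D_shear, of inverse "- inverse (u^2)"] DERIV_inverse[OF u0]
    by (simp add: o_def u_def power2_eq_square)
  have "((\<lambda>x. cnj (shear x w) * inverse (shear x w)) has_vector_derivative
      cnj u * ((\<i> * of_real a) * (- inverse (u^2))) + (- \<i> * of_real a) * inverse u) (at s)"
    using has_vector_derivative_mult[OF D_cnj D_inv] by (simp add: u_def)
  also have "cnj u * ((\<i> * of_real a) * (- inverse (u^2))) + (- \<i> * of_real a) * inverse u
      = - \<i> * of_real a * (u + cnj u) / u^2"
    using u0 by (simp add: field_simps power2_eq_square)
  finally have D_quot: "((\<lambda>x. cnj (shear x w) / shear x w) has_vector_derivative
      - \<i> * of_real a * (u + cnj u) / u^2) (at s)"
    by (simp add: divide_inverse)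
  define v where "v = cnj u / u"
  have v0: "v \<noteq> 0" using u0 by (simp add: v_def)
  have D_powi: "((\<lambda>y. y powi k) has_field_derivative of_int k * v powi (k - 1)) (at v)"
    using v0 by (auto intro!: derivative_eq_intros)
  have D_vk: "((\<lambda>x. (cnj (shear x w) / shear x w) powi k) has_vector_derivative
      (- \<i> * of_real a * (u + cnj u) / u^2) * (of_int k * v powi (k - 1))) (at s)"
    using field_vector_diff_chain_at[OF D_quot, of "\<lambda>y. y powi k" "of_int k * v powi (k - 1)"] D_powi
    by (simp add: o_def u_def v_def)
  have "((\<lambda>x. harmonic (2*l) k (shear x w)) has_vector_derivative
      of_real (cmod u powr (2*l)) * ((- \<i> * of_real a * (u + cnj u) / u^2) * (of_int k * v powi (k - 1)))
     + of_real (2 * l * cmod u powr (2*l) * Im u * a / (cmod u)\<^sup>2) * v powi k) (at s)"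
    using has_vector_derivative_mult[OF D_pow D_vk]
    unfolding harmonic_def u_def[symmetric] v_def[symmetric] .
  moreover have "of_real (cmod u powr (2*l)) * ((- \<i> * of_real a * (u + cnj u) / u^2) * (of_int k * v powi (k - 1)))
     + of_real (2 * l * cmod u powr (2*l) * Im u * a / (cmod u)\<^sup>2) * v powi k = flow_deriv l k u"
  proof -
    define P where "P = complex_of_real (cmod u powr (2*l))"
    define V where "V = v powi k"
    have vk: "v powi (k - 1) = V / v" "v powi (k + 1) = V * v"
      using v0 by (simp_all add: V_def power_int_diff power_int_add)
    have h: "harmonic (2*l) k u = P * V" "harmonic (2*l) (k+1) u = P * (V * v)"
        "harmonic (2*l) (k-1) u = P * (V / v)"
      unfolding harmonic_def v_def[symmetric] P_def vk V_def by simp_all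
    have n2: "complex_of_real ((cmod u)\<^sup>2) = u * cnj u"
      by (rule complex_norm_square)
    have aa: "complex_of_real a = (u + cnj u) / 2"
      by (simp add: complex_add_cnj Reu)
    have ii: "complex_of_real (Im u) = (u - cnj u) / (2 * \<i>)"
      by (simp add: complex_diff_cnj complex_eq_iff)
    \<comment> \<open>With |u|^2, Re u and Im u written through u and its conjugate, the claim is a
      rational identity in which z = u and c = cnj u may be treated as independent.\<close>
    have alg: "p * ((- \<i> * ((z + c) / 2) * (z + c) / z\<^sup>2) * (j * (v / (c / z))))
          + 2 * m * p * ((z - c) / (2 * \<i>)) * ((z + c) / 2) / (z * c) * v
        = \<i> / 2 * ((m - j) * (p * (v * (c / z))) - 2 * j * (p * v) - (m + j) * (p * (v / (c / z))))"
      if "z \<noteq> 0" "c \<noteq> 0" for p z c j v m :: complex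
      using that by (simp add: field_simps power2_eq_square)
    show ?thesis
      using alg[of u "cnj u" P "of_int k" V "of_real l"] u0
      unfolding flow_deriv_def h vk V_def[symmetric] of_real_mult of_real_divide n2 P_def[symmetric]
        aa ii
      by (simp add: v_def)
  qed
  ultimately show ?thesis by (simp add: u_def)
qed

section \<open>Exponential averages of the shear flow\<close>

abbreviation exponential_law :: "real \<Rightarrow> real measure" where
  "exponential_law \<rho> \<equiv> density lborel (exponential_density \<rho>)"

lemma integrable_exponential_law_abs:
  assumes "0 < \<rho>"
  shows "integrable (exponential_law \<rho>) (\<lambda>s. 1 + \<bar>s\<bar>)"
proof -
  interpret prob_space "exponential_law \<rho>"
    using assms by (rule prob_space_exponential_density)
  have "distributed (exponential_law \<rho>) lborel (\<lambda>x. x) (exponential_density \<rho>)"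
    by (simp add: distributed_def distr_id2)
  then have "integrable (exponential_law \<rho>) (\<lambda>x. x ^ 1)"
    by (rule erlang_ith_moment_integrable[OF assms])
  then show ?thesis by simp
qed

lemma integrable_shear:
  fixes \<phi> :: "complex \<Rightarrow> complex"
  assumes "0 < \<rho>" "0 < q" "q \<le> 1" and [measurable]: "\<phi> \<in> borel_measurable borel"
    and "\<And>z. cmod (\<phi> z) \<le> C * cmod z powr q"
  shows "integrable (exponential_law \<rho>) (\<lambda>s. \<phi> (shear s w))"
proof (rule Bochner_Integration.integrable_bound)
  show "integrable (exponential_law \<rho>) (\<lambda>s. \<bar>C\<bar> * cmod w powr q * (1 + \<bar>s\<bar>))"
    using integrable_exponential_law_abs[OF assms(1)] by (rule integrable_mult_right)
  have "cmod (\<phi> (shear s w)) \<le> \<bar>C\<bar> * cmod w powr q * (1 + \<bar>s\<bar>)" for s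
  proof -
    have "cmod (\<phi> (shear s w)) \<le> \<bar>C\<bar> * cmod (shear s w) powr q"
      by (rule order_trans[OF assms(5)]) (simp add: mult_right_mono)
    also have "\<dots> \<le> \<bar>C\<bar> * ((1 + \<bar>s\<bar>) * cmod w powr q)"
      using assms by (intro mult_left_mono shear_powr_le) auto
    finally show ?thesis by (simp add: algebra_simps)
  qed
  then show "AE s in exponential_law \<rho>. cmod (\<phi> (shear s w)) \<le> norm (\<bar>C\<bar> * cmod w powr q * (1 + \<bar>s\<bar>))"
    by simp
qed simp

text \<open>The exponential average is the resolvent of the shear flow, so it inverts
  \<open>1 - D/\<rho>\<close> with \<open>D\<close> the generator of the flow.\<close>

lemma exponential_average_resolvent:
  assumes "0 < \<rho>" "0 < l" "l \<le> 1/2"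
  shows "(\<integral>s. harmonic (2*l) k (shear s w) - flow_deriv l k (shear s w) / \<rho> \<partial>exponential_law \<rho>)
    = harmonic (2*l) k w" (is "(\<integral>s. ?\<psi> s \<partial>_) = _")
proof (cases "w = 0")
  case False
  define h where "h s = harmonic (2*l) k (shear s w)" for s
  \<comment> \<open>An antiderivative of \<open>f\<close>, the integrand weighted by the density:
    differentiating \<open>h\<close> gives the generator term, differentiating the exponential gives
    the other. As \<open>F\<close> vanishes at infinity, the integral is - \<open>F 0\<close> =
    \<open>h 0\<close>.\<close>
  define F where "F s = - (exp (- \<rho> * s) *\<^sub>R h s)" for s
  define f where "f s = (\<rho> * exp (- \<rho> * s)) *\<^sub>R ?\<psi> s" for s
  have bound: "cmod (h s) \<le> (1 + \<bar>s\<bar>) * cmod w powr (2*l)" for s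
    using shear_powr_le[of "2*l" s w] assms by (simp add: h_def)
  have D: "(h has_vector_derivative flow_deriv l k (shear s w)) (at s)" for s
    unfolding h_def using False by (rule harmonic_flow_deriv)
  have hcont: "isCont (\<lambda>s. harmonic (2*l) j (shear s w)) s" for s j
    using harmonic_flow_deriv[OF False, of l j s] has_vector_derivative_continuous by blast
  have fcont: "isCont f s" for s
    unfolding f_def flow_deriv_def using assms by (intro continuous_intros hcont) auto
  have DF: "(F has_vector_derivative f s) (at s)" for s
  proof -
    have "((\<lambda>s. exp (- \<rho> * s)) has_real_derivative (- \<rho> * exp (- \<rho> * s))) (at s)"
      by (auto intro!: derivative_eq_intros)
    then have "(F has_vector_derivative
        - (exp (- \<rho> * s) *\<^sub>R flow_deriv l k (shear s w) + (- \<rho> * exp (- \<rho> * s)) *\<^sub>R h s)) (at s)"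
      unfolding F_def
      by (intro has_vector_derivative_minus has_vector_derivative_scaleR D)
    also have "- (exp (- \<rho> * s) *\<^sub>R flow_deriv l k (shear s w) + (- \<rho> * exp (- \<rho> * s)) *\<^sub>R h s) = f s"
      using assms by (simp add: f_def h_def scaleR_conv_of_real algebra_simps)
    finally show ?thesis .
  qed
  have int\<psi>: "integrable (exponential_law \<rho>) ?\<psi>"
    using assms
      integrable_shear[of \<rho> "2*l" "harmonic (2*l) k" 1 w]
      integrable_shear[of \<rho> "2*l" "flow_deriv l k", OF _ _ _ _ norm_flow_deriv_le]
    by auto
  have meas [measurable]: "?\<psi> \<in> borel_measurable borel"
    by measurable
  \<comment> \<open>At s = 0 the density is \<rho> while the indicator of the open half-line is 0;
    the two sides can differ only at this null point.\<close>
  have dens: "indicator {0<..} s *\<^sub>R f s = exponential_density \<rho> s *\<^sub>R ?\<psi> s" if "s \<noteq> 0" for s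
    using that by (auto simp: exponential_density_def f_def mult.commute indicator_def)
  have AE: "AE s in lborel. indicator {0<..} s *\<^sub>R f s = exponential_density \<rho> s *\<^sub>R ?\<psi> s"
    using AE_lborel_singleton[of "0::real"] by eventually_elim (rule dens)
  have [measurable]: "f \<in> borel_measurable borel"
    unfolding f_def by measurable
  have "set_integrable lborel {0<..} f"
    unfolding set_integrable_def
    using int\<psi> assms
    by (subst integrable_cong_AE[OF _ _ AE]) (auto simp: integrable_density exponential_density_def)
  moreover have "(F \<longlongrightarrow> F 0) (at_right 0)"
    using DF[of 0] has_vector_derivative_continuous[of F "f 0" 0 UNIV]
    by (simp add: continuous_at filterlim_at_split)
  moreover have "(F \<longlongrightarrow> 0) at_top"
  proof (rule Lim_null_comparison)
    show "\<forall>\<^sub>F s in at_top. norm (F s) \<le> exp (- \<rho> * s) * ((1 + \<bar>s\<bar>) * cmod w powr (2*l))"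
      by (auto simp: F_def intro!: mult_left_mono bound always_eventually)
    have "((\<lambda>s. exp (- \<rho> * s) * (1 + \<bar>s\<bar>)) \<longlongrightarrow> 0) at_top"
      using assms by real_asymp
    from tendsto_mult_left[OF this, of "cmod w powr (2*l)"]
    show "((\<lambda>s. exp (- \<rho> * s) * ((1 + \<bar>s\<bar>) * cmod w powr (2*l))) \<longlongrightarrow> 0) at_top"
      by (simp add: algebra_simps)
  qed
  moreover have "einterval 0 \<infinity> = {0<..}"
    by (auto simp: einterval_def)
  ultimately have "(LBINT s=0..\<infinity>. f s) = 0 - F 0"
    by (intro interval_integral_FTC_integrable[where F = F])
       (simp_all add: DF fcont zero_ereal_def ereal_tendsto_simps)
  then have "(\<integral>s. indicator {0<..} s *\<^sub>R f s \<partial>lborel) = h 0"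
    by (simp add: interval_integral_to_infinity_eq set_lebesgue_integral_def F_def zero_ereal_def)
  also have "(\<integral>s. indicator {0<..} s *\<^sub>R f s \<partial>lborel) = (\<integral>s. exponential_density \<rho> s *\<^sub>R ?\<psi> s \<partial>lborel)"
    by (rule integral_cong_AE[OF _ _ AE]) auto
  also have "\<dots> = (\<integral>s. ?\<psi> s \<partial>exponential_law \<rho>)"
    using assms by (subst integral_density) (auto simp: exponential_density_def)
  finally show ?thesis by (simp add: h_def shear_def)
qed simp

section \<open>The transfer operator and the random walk\<close>

text \<open>A row vector multiplied by g_n ... g_1 meets g_n first. Hence step \<open>Suc n\<close>
  is taken before the walk of length n.\<close>

primrec walk :: "(nat \<Rightarrow> real \<times> real) \<Rightarrow> nat \<Rightarrow> complex \<Rightarrow> complex" where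
  "walk p 0 z = z"
| "walk p (Suc n) z = walk p n (step (p (Suc n)) z)"

lemma walk_linear:
  "walk p n (of_real a * z + of_real b * w) = of_real a * walk p n z + of_real b * walk p n w"
  by (induction n arbitrary: z w) (simp_all add: step_linear)

lemma walk_eq_0_iff [simp]: "walk p n z = 0 \<longleftrightarrow> z = 0"
  by (induction n arbitrary: z) simp_all

lemma walk_cong: "(\<And>j. j \<in> {1..n} \<Longrightarrow> p j = p' j) \<Longrightarrow> walk p n z = walk p' n z"
  by (induction n arbitrary: z) simp_all

lemma walk_powr_le:
  assumes "0 < q" "q \<le> 1"
  shows "cmod (walk p n z) powr q \<le> (\<Prod>j\<in>{1..n}. 1 + \<bar>snd (p j)\<bar>) * cmod z powr q"
proof (induction n arbitrary: z)
  case (Suc n)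
  have "cmod (walk p (Suc n) z) powr q
      \<le> (\<Prod>j\<in>{1..n}. 1 + \<bar>snd (p j)\<bar>) * cmod (step (p (Suc n)) z) powr q"
    using Suc[of "step (p (Suc n)) z"] by simp
  also have "\<dots> \<le> (\<Prod>j\<in>{1..n}. 1 + \<bar>snd (p j)\<bar>) * ((1 + \<bar>snd (p (Suc n))\<bar>) * cmod z powr q)"
    by (intro mult_left_mono step_powr_le assms prod_nonneg) auto
  finally show ?case by (simp add: algebra_simps)
qed simp

text \<open>Real linearity expresses the walk from z through the walks from 1 and \<i>, and x^q is
  subadditive for q \<le> 1. These two starts thus control all others, which is what makes the
  moments submultiplicative.\<close>

lemma walk_powr_subadditive:
  assumes "0 < q" "q \<le> 1"
  shows "cmod (walk p n z) powr q
    \<le> (cmod (walk p n 1) powr q + cmod (walk p n \<i>) powr q) * cmod z powr q"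
proof -
  have sub: "(a + b) powr q \<le> a powr q + b powr q" if "0 \<le> a" "0 \<le> b" for a b :: real
  proof (cases "a + b = 0")
    case False
    then have pos: "a + b > 0" using that by linarith
    \<comment> \<open>A number in [0, 1] does not decrease when raised to a power q \<le> 1; this is
      applied to two fractions that add up to 1.\<close>
    have "(c / (a + b)) powr q \<ge> c / (a + b)" if "0 \<le> c" "c \<le> a + b" for c
      using powr_mono'[of q 1 "c / (a + b)"] that assms pos by (auto simp: divide_simps)
    from this[of a] this[of b] that have "a / (a+b) + b / (a+b) \<le> (a / (a + b)) powr q + (b / (a + b)) powr q"
      by (intro add_mono) auto
    then have "1 \<le> (a powr q + b powr q) / (a + b) powr q"
      using pos that by (simp add: powr_divide flip: add_divide_distrib)
    then show ?thesis
      using pos by (simp add: field_simps)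
  qed (use that in simp)
  have "z = of_real (Re z) * 1 + of_real (Im z) * \<i>"
    by (simp add: complex_eq_iff)
  then have "walk p n z = of_real (Re z) * walk p n 1 + of_real (Im z) * walk p n \<i>"
    by (metis walk_linear)
  then have "cmod (walk p n z) \<le> \<bar>Re z\<bar> * cmod (walk p n 1) + \<bar>Im z\<bar> * cmod (walk p n \<i>)"
    using norm_triangle_ineq[of "of_real (Re z) * walk p n 1" "of_real (Im z) * walk p n \<i>"]
    by (simp add: norm_mult)
  also have "\<dots> \<le> cmod z * cmod (walk p n 1) + cmod z * cmod (walk p n \<i>)"
    by (intro add_mono mult_right_mono abs_Re_le_cmod abs_Im_le_cmod) auto
  finally have "cmod (walk p n z) powr q \<le> (cmod z * (cmod (walk p n 1) + cmod (walk p n \<i>))) powr q"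
    using assms by (intro powr_mono2) (auto simp: algebra_simps)
  also have "\<dots> = cmod z powr q * (cmod (walk p n 1) + cmod (walk p n \<i>)) powr q"
    by (simp add: powr_mult)
  also have "\<dots> \<le> cmod z powr q * (cmod (walk p n 1) powr q + cmod (walk p n \<i>) powr q)"
    by (intro mult_left_mono sub) auto
  finally show ?thesis by (simp add: mult.commute)
qed

text \<open>\<open>K\<close> is the law of the angle. The range 0 < l \<le> 1/2 keeps the norm
  exponent 2l in (0, 1], where subadditivity and the first-moment bounds hold; expansion
  coefficients at 0 can be read off from l > 0 alone.\<close>

locale rotation_shear_walk =
  fixes K :: "real measure" and \<rho> l :: real
  assumes prob_K: "prob_space K" and sets_K [measurable_cong]: "sets K = sets borel"
    and \<rho>_pos: "0 < \<rho>" and l_pos: "0 < l" and l_le: "l \<le> 1/2"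
begin

lemma q_bounds: "0 < 2 * l" "2 * l \<le> 1"
  using l_pos l_le by auto

section \<open>One-step law, transfer operator and admissible observables\<close>

definition step_law :: "(real \<times> real) measure" where
  "step_law = K \<Otimes>\<^sub>M exponential_law \<rho>"

definition transfer :: "(complex \<Rightarrow> complex) \<Rightarrow> complex \<Rightarrow> complex" where
  "transfer \<phi> z = (\<integral>p. \<phi> (step p z) \<partial>step_law)"

text \<open>A growth class that contains the harmonics and their images under the generator, is
  preserved by \<open>transfer\<close>, and makes all expectations along the walk finite.\<close>

definition admissible :: "(complex \<Rightarrow> complex) \<Rightarrow> bool" where
  "admissible \<phi> \<longleftrightarrow> \<phi> \<in> borel_measurable borel \<and> (\<exists>C. \<forall>z. cmod (\<phi> z) \<le> C * cmod z powr (2*l))"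

definition walk_law :: "nat \<Rightarrow> (nat \<Rightarrow> real \<times> real) measure" where
  "walk_law n = Pi\<^sub>M {1..n} (\<lambda>_. step_law)"

sublocale exponential: prob_space "exponential_law \<rho>"
  using \<rho>_pos by (rule prob_space_exponential_density)

sublocale K: prob_space K
  by (rule prob_K)

sublocale pair_prob_space K "exponential_law \<rho>" ..

sublocale steps: prob_space step_law
  unfolding step_law_def by (rule prob_space_axioms)

sublocale walks: product_prob_space "\<lambda>_::nat. step_law" ..

lemma sets_step_law [measurable_cong]: "sets step_law = sets (borel \<Otimes>\<^sub>M borel)"
  unfolding step_law_def by (intro sets_pair_measure_cong sets_K) simp

lemma sets_walk_law [measurable_cong]: "sets (walk_law n) = sets (Pi\<^sub>M {1..n} (\<lambda>_. borel \<Otimes>\<^sub>M borel))"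
  unfolding walk_law_def by (intro sets_PiM_cong sets_step_law refl)

lemma admissibleE:
  assumes "admissible \<phi>"
  obtains C where "\<phi> \<in> borel_measurable borel" "0 \<le> C" "\<forall>z. cmod (\<phi> z) \<le> C * cmod z powr (2*l)"
proof -
  from assms obtain C where C: "\<phi> \<in> borel_measurable borel" "\<forall>z. cmod (\<phi> z) \<le> C * cmod z powr (2*l)"
    by (auto simp: admissible_def)
  have "0 \<le> C" using order_trans[OF norm_ge_zero spec[OF C(2), of 1]] by simp
  with C that show ?thesis by blast
qed

lemma admissibleI:
  "\<phi> \<in> borel_measurable borel \<Longrightarrow> (\<And>z. cmod (\<phi> z) \<le> C * cmod z powr (2*l)) \<Longrightarrow> admissible \<phi>"
  unfolding admissible_def by (intro conjI exI[of _ C] allI)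

lemma admissible_harmonic: "admissible (harmonic (2*l) k)"
  unfolding admissible_def by (auto intro!: exI[of _ 1])

lemma admissible_flow_deriv: "admissible (flow_deriv l k)"
  unfolding admissible_def using norm_flow_deriv_le[of l k] by auto

lemma admissible_diff:
  assumes "admissible \<phi>" "admissible \<psi>"
  shows "admissible (\<lambda>z. \<phi> z - \<psi> z)"
proof -
  obtain C where C: "\<phi> \<in> borel_measurable borel" "0 \<le> C" "\<forall>z. cmod (\<phi> z) \<le> C * cmod z powr (2*l)"
    by (rule admissibleE[OF assms(1)])
  note C = C(1,2) C(3)[rule_format]
  obtain D where D: "\<psi> \<in> borel_measurable borel" "0 \<le> D" "\<forall>z. cmod (\<psi> z) \<le> D * cmod z powr (2*l)"
    by (rule admissibleE[OF assms(2)])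
  note D = D(1,2) D(3)[rule_format]
  show ?thesis
  proof (rule admissibleI)
    show "(\<lambda>z. \<phi> z - \<psi> z) \<in> borel_measurable borel"
      using C(1) D(1) by (rule borel_measurable_diff)
    show "cmod (\<phi> z - \<psi> z) \<le> (C + D) * cmod z powr (2*l)" for z
      using norm_triangle_ineq4[of "\<phi> z" "\<psi> z"] C(3)[of z] D(3)[of z] by (simp add: algebra_simps)
  qed
qed

lemma admissible_mult:
  assumes "admissible \<phi>"
  shows "admissible (\<lambda>z. c * \<phi> z)"
proof -
  obtain C where C: "\<phi> \<in> borel_measurable borel" "0 \<le> C" "\<forall>z. cmod (\<phi> z) \<le> C * cmod z powr (2*l)"
    by (rule admissibleE[OF assms])
  note C = C(1,2) C(3)[rule_format]
  show ?thesis
  proof (rule admissibleI)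
    show "(\<lambda>z. c * \<phi> z) \<in> borel_measurable borel"
      using C(1) by simp
    show "cmod (c * \<phi> z) \<le> (cmod c * C) * cmod z powr (2*l)" for z
      using mult_left_mono[OF C(3)[of z], of "cmod c"] by (simp add: norm_mult)
  qed
qed

lemma admissible_divide: "admissible \<phi> \<Longrightarrow> admissible (\<lambda>z. \<phi> z / c)"
  using admissible_mult[of \<phi> "inverse c"] by (simp add: divide_inverse mult.commute)

lemma integrable_step_bound: "integrable step_law (\<lambda>p. 1 + \<bar>snd p\<bar>)"
proof -
  have "distr step_law (exponential_law \<rho>) snd = exponential_law \<rho>"
  proof (rule measure_eqI)
    fix A assume A: "A \<in> sets (distr step_law (exponential_law \<rho>) snd)"
    then have "snd -` A \<inter> space (K \<Otimes>\<^sub>M exponential_law \<rho>) = space K \<times> A"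
      by (auto simp: space_pair_measure)
    with A show "emeasure (distr step_law (exponential_law \<rho>) snd) A = emeasure (exponential_law \<rho>) A"
      unfolding step_law_def
      by (simp add: emeasure_distr exponential.emeasure_pair_measure_Times K.emeasure_space_1)
  qed simp
  then have "integrable (distr step_law (exponential_law \<rho>) snd) (\<lambda>s. 1 + \<bar>s\<bar>)"
    using integrable_exponential_law_abs[OF \<rho>_pos] by simp
  then show ?thesis
    by (subst (asm) integrable_distr_eq) (auto simp: step_law_def)
qed

lemma integrable_step:
  assumes "admissible \<phi>"
  shows "integrable step_law (\<lambda>p. \<phi> (step p z))"
proof -
  obtain C where C: "\<phi> \<in> borel_measurable borel" "0 \<le> C" "\<forall>z. cmod (\<phi> z) \<le> C * cmod z powr (2*l)"
    by (rule admissibleE[OF assms])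
  note C = C(1,2) C(3)[rule_format]
  note [measurable] = C(1)
  have "cmod (\<phi> (step p z)) \<le> C * ((1 + \<bar>snd p\<bar>) * cmod z powr (2*l))" for p
    using C(2) by (intro order_trans[OF C(3)] mult_left_mono step_powr_le q_bounds)
  then have bound: "cmod (\<phi> (step p z)) \<le> norm ((C * cmod z powr (2*l)) * (1 + \<bar>snd p\<bar>))" for p
    unfolding real_norm_def by (intro order_trans[OF _ abs_ge_self]) (simp only: mult_ac)
  have "(\<lambda>p. \<phi> (step p z)) \<in> borel_measurable step_law"
    by measurable
  then show ?thesis
    by (rule Bochner_Integration.integrable_bound[OF
          integrable_mult_right[OF integrable_step_bound] _ AE_I2[OF bound]])
qed

lemma admissible_transfer:
  assumes "admissible \<phi>"
  shows "admissible (transfer \<phi>)"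
proof -
  obtain C where C: "\<phi> \<in> borel_measurable borel" "0 \<le> C" "\<forall>z. cmod (\<phi> z) \<le> C * cmod z powr (2*l)"
    by (rule admissibleE[OF assms])
  note C = C(1,2) C(3)[rule_format]
  note [measurable] = C(1)
  have "cmod (transfer \<phi> z) \<le> (C * (\<integral>p. 1 + \<bar>snd p\<bar> \<partial>step_law)) * cmod z powr (2*l)" for z
  proof -
    have "cmod (transfer \<phi> z) \<le> (\<integral>p. C * cmod z powr (2*l) * (1 + \<bar>snd p\<bar>) \<partial>step_law)"
      unfolding transfer_def
    proof (rule order_trans[OF integral_norm_bound], rule integral_mono)
      show "cmod (\<phi> (step p z)) \<le> C * cmod z powr (2*l) * (1 + \<bar>snd p\<bar>)" for p
        using mult_left_mono[OF step_powr_le[OF q_bounds, of p z] C(2)]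
        by (intro order_trans[OF C(3)]) (simp add: algebra_simps)
    qed (intro integrable_norm integrable_step assms integrable_mult_right integrable_step_bound)+
    then show ?thesis by (simp add: mult_ac)
  qed
  moreover have "transfer \<phi> \<in> borel_measurable borel"
    unfolding transfer_def by measurable
  ultimately show ?thesis by (intro admissibleI)
qed

lemma admissible_funpow_transfer: "admissible \<phi> \<Longrightarrow> admissible ((transfer ^^ n) \<phi>)"
  by (induction n) (auto intro: admissible_transfer)

text \<open>By Fubini the shear is averaged first, with the rotated point fixed. The resolvent
  identity leaves the bare harmonic at that point, and averaging its rotation eigenvalue over
  \<open>K\<close> gives the characteristic function.\<close>

lemma transfer_resolvent:
  "transfer (\<lambda>z. harmonic (2*l) k z - flow_deriv l k z / \<rho>) z = char K (of_int k) * harmonic (2*l) k z"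
proof -
  let ?\<phi> = "\<lambda>z. harmonic (2*l) k z - flow_deriv l k z / \<rho>"
  have "transfer ?\<phi> z = (\<integral>t. (\<integral>s. ?\<phi> (step (t, s) z) \<partial>exponential_law \<rho>) \<partial>K)"
    using integrable_step[of ?\<phi> z, OF admissible_diff[OF admissible_harmonic
        admissible_divide[OF admissible_flow_deriv]]]
    unfolding transfer_def step_law_def by (rule integral_fst'[symmetric])
  also have "\<dots> = (\<integral>t. cis (t * of_int k) * harmonic (2*l) k z \<partial>K)"
    unfolding step_def fst_conv snd_conv
    by (simp only: exponential_average_resolvent[OF \<rho>_pos l_pos l_le] harmonic_rotate)
  also have "\<dots> = (\<integral>t. cis (t * of_int k) \<partial>K) * harmonic (2*l) k z"
    by simp
  also have "(\<integral>t. cis (t * of_int k) \<partial>K) = char K (of_int k)"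
    unfolding char_def by (simp add: cis_conv_exp mult.commute)
  finally show ?thesis .
qed

section \<open>Expectations along the walk\<close>

lemma measurable_walk:
  assumes "h \<in> borel_measurable (walk_law m)" "n \<le> m"
  shows "(\<lambda>p. walk p n (h p)) \<in> borel_measurable (walk_law m)"
  using assms
\<comment> \<open>The recursion moves a random step into the starting point, so the induction runs
  over path-dependent starting points \<open>h\<close>.\<close>
proof (induction n arbitrary: h)
  case (Suc n)
  have "(\<lambda>p. p (Suc n)) \<in> walk_law m \<rightarrow>\<^sub>M borel \<Otimes>\<^sub>M borel"
    unfolding measurable_cong_sets[OF sets_walk_law refl]
    by (rule measurable_component_singleton) (use Suc.prems in auto)
  then have "(\<lambda>p. step (p (Suc n)) (h p)) \<in> borel_measurable (walk_law m)"
    using Suc.prems(1) by (rule measurable_step)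
  then show ?case
    using Suc.prems(2) by (simp add: Suc.IH)
qed simp

lemma integrable_walk:
  assumes "admissible \<phi>"
  shows "integrable (walk_law n) (\<lambda>p. \<phi> (walk p n z))"
proof -
  obtain C where C: "\<phi> \<in> borel_measurable borel" "0 \<le> C" "\<forall>z. cmod (\<phi> z) \<le> C * cmod z powr (2*l)"
    by (rule admissibleE[OF assms])
  note C = C(1,2) C(3)[rule_format]
  note [measurable] = C(1)
  have [measurable]: "(\<lambda>p. walk p n z) \<in> borel_measurable (walk_law n)"
    by (rule measurable_walk) auto
  have int: "integrable (walk_law n) (\<lambda>p. (C * cmod z powr (2*l)) * (\<Prod>j\<in>{1..n}. 1 + \<bar>snd (p j)\<bar>))"
    unfolding walk_law_def
    by (intro integrable_mult_right walks.product_integrable_prod integrable_step_bound) simp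
  have "cmod (\<phi> (walk p n z)) \<le> C * ((\<Prod>j\<in>{1..n}. 1 + \<bar>snd (p j)\<bar>) * cmod z powr (2*l))" for p
    using C(2) by (intro order_trans[OF C(3)] mult_left_mono walk_powr_le q_bounds)
  then have bound: "cmod (\<phi> (walk p n z)) \<le> norm ((C * cmod z powr (2*l)) * (\<Prod>j\<in>{1..n}. 1 + \<bar>snd (p j)\<bar>))" for p
    unfolding real_norm_def by (intro order_trans[OF _ abs_ge_self]) (simp only: mult_ac)
  have "(\<lambda>p. \<phi> (walk p n z)) \<in> borel_measurable (walk_law n)"
    by measurable
  then show ?thesis
    by (rule Bochner_Integration.integrable_bound[OF int _ AE_I2[OF bound]])
qed

text \<open>Coordinate \<open>Suc n\<close> is used first, so Fubini splits it off; by induction the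
  integral over the remaining coordinates is an iterate of \<open>transfer\<close> evaluated after
  one step.\<close>

lemma integral_walk:
  assumes "admissible \<phi>"
  shows "(\<integral>p. \<phi> (walk p n z) \<partial>walk_law n) = (transfer ^^ n) \<phi> z"
proof (induction n arbitrary: z)
  case 0
  show ?case by (simp add: walk_law_def PiM_empty)
next
  case (Suc n)
  have "(\<integral>p. \<phi> (walk p (Suc n) z) \<partial>walk_law (Suc n))
      = (\<integral>p. \<phi> (walk p (Suc n) z) \<partial>Pi\<^sub>M ({Suc n} \<union> {1..n}) (\<lambda>_. step_law))"
    unfolding walk_law_def by (simp add: atLeastAtMostSuc_conv)
  also have "\<dots> = (\<integral>x. (\<integral>y. \<phi> (walk (merge {Suc n} {1..n} (x, y)) (Suc n) z)
      \<partial>Pi\<^sub>M {1..n} (\<lambda>_. step_law)) \<partial>Pi\<^sub>M {Suc n} (\<lambda>_. step_law))"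
    by (rule walks.product_integral_fold)
       (use integrable_walk[OF assms, of "Suc n" z] in \<open>auto simp: walk_law_def atLeastAtMostSuc_conv\<close>)
  \<comment> \<open>Beyond the step already taken, \<open>walk\<close> reads only the coordinates 1
    to n, where the merged path agrees with y.\<close>
  also have "\<dots> = (\<integral>x. (\<integral>y. \<phi> (walk y n (step (x (Suc n)) z)) \<partial>walk_law n) \<partial>Pi\<^sub>M {Suc n} (\<lambda>_. step_law))"
    unfolding walk_law_def walk.simps
    by (intro Bochner_Integration.integral_cong refl arg_cong[of _ _ \<phi>])
       (auto simp: merge_def intro!: walk_cong)
  also have "\<dots> = (\<integral>x. (transfer ^^ n) \<phi> (step (x (Suc n)) z) \<partial>Pi\<^sub>M {Suc n} (\<lambda>_. step_law))"
    by (simp add: Suc.IH)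
  also have "\<dots> = (\<integral>p. (transfer ^^ n) \<phi> (step p z) \<partial>step_law)"
    by (rule walks.product_integral_singleton)
       (rule borel_measurable_integrable[OF integrable_step[OF admissible_funpow_transfer[OF assms]]])
  also have "\<dots> = (transfer ^^ Suc n) \<phi> z"
    by (simp add: transfer_def)
  finally show ?case .
qed

subsection \<open>Growth of the moments and the perturbed Dyson--Schmidt equation\<close>

definition moment :: "nat \<Rightarrow> complex \<Rightarrow> real" where
  "moment n z = (\<integral>p. cmod (walk p n z) powr (2*l) \<partial>walk_law n)"

definition moment_sum :: "nat \<Rightarrow> real" where
  "moment_sum n = moment n 1 + moment n \<i>"

text \<open>Fourier coefficients at level n, summed over the same starts 1 and \<i> as
  \<open>moment_sum\<close>, so that index 0 returns the submultiplicative sequence.\<close>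

definition coeff :: "nat \<Rightarrow> int \<Rightarrow> complex" where
  "coeff n k = (transfer ^^ n) (harmonic (2*l) k) 1 + (transfer ^^ n) (harmonic (2*l) k) \<i>"

lemma integrable_moment: "integrable (walk_law n) (\<lambda>p. cmod (walk p n z) powr (2*l))"
  using integrable_norm[OF integrable_walk[OF admissible_harmonic, of n 0 z]] by simp

lemma funpow_transfer_harmonic_0:
  "(transfer ^^ n) (harmonic (2*l) 0) z = of_real (moment n z)"
  unfolding moment_def integral_walk[OF admissible_harmonic, symmetric] harmonic_zero
  by (rule integral_complex_of_real)

lemma norm_funpow_transfer_harmonic_le:
  "cmod ((transfer ^^ n) (harmonic (2*l) k) z) \<le> moment n z"
  unfolding moment_def integral_walk[OF admissible_harmonic, symmetric]
  using integral_norm_bound[of "walk_law n" "\<lambda>p. harmonic (2*l) k (walk p n z)"] by simp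

section \<open>Positivity, submultiplicativity and exponential rate of the moments\<close>

lemma moment_pos:
  assumes "z \<noteq> 0"
  shows "0 < moment n z"
proof -
  interpret W: prob_space "walk_law n"
    unfolding walk_law_def by (rule prob_space_PiM) (rule steps.prob_space_axioms)
  have nonneg: "0 \<le> moment n z"
    unfolding moment_def by (intro integral_nonneg_AE) simp
  have "moment n z \<noteq> 0"
  proof
    assume "moment n z = 0"
    then have "AE p in walk_law n. cmod (walk p n z) powr (2*l) = 0"
      unfolding moment_def
      by (subst (asm) integral_nonneg_eq_0_iff_AE[OF integrable_moment]) auto
    then have "AE p in walk_law n. False"
      using assms by simp
    then show False by simp
  qed
  with nonneg show ?thesis by simp
qed

lemma moment_le_moment_sum: "moment n z \<le> moment_sum n * cmod z powr (2*l)"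
proof -
  have "moment n z \<le> (\<integral>p. (cmod (walk p n 1) powr (2*l) + cmod (walk p n \<i>) powr (2*l))
      * cmod z powr (2*l) \<partial>walk_law n)"
    unfolding moment_def
    by (intro integral_mono walk_powr_subadditive q_bounds integrable_moment
        integrable_mult_left Bochner_Integration.integrable_add)
  also have "\<dots> = moment_sum n * cmod z powr (2*l)"
    unfolding moment_sum_def moment_def
    by (simp add: Bochner_Integration.integral_add[OF integrable_moment integrable_moment])
  finally show ?thesis .
qed

text \<open>Restart the walk after m steps: the remaining n steps see a random starting point, and
  their mean is bounded by \<open>moment_sum n\<close> times the 2l-th power of its modulus.\<close>

lemma moment_add_le: "moment (m + n) z \<le> moment_sum n * moment m z"
proof -
  let ?h = "(transfer ^^ n) (harmonic (2*l) 0)"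
  have adm: "admissible ?h"
    by (intro admissible_funpow_transfer admissible_harmonic)
  have "of_real (moment (m + n) z) = (transfer ^^ m) ?h z"
    by (simp add: funpow_transfer_harmonic_0[symmetric] funpow_add)
  also have "\<dots> = (\<integral>p. complex_of_real (moment n (walk p m z)) \<partial>walk_law m)"
    unfolding integral_walk[OF adm, symmetric] by (simp add: funpow_transfer_harmonic_0)
  also have "\<dots> = of_real (\<integral>p. moment n (walk p m z) \<partial>walk_law m)"
    by (rule integral_complex_of_real)
  finally have "moment (m + n) z = (\<integral>p. moment n (walk p m z) \<partial>walk_law m)"
    by (simp only: of_real_eq_iff)
  also have "\<dots> \<le> (\<integral>p. moment_sum n * cmod (walk p m z) powr (2*l) \<partial>walk_law m)"
  proof (intro integral_mono moment_le_moment_sum integrable_mult_right integrable_moment)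
    show "integrable (walk_law m) (\<lambda>p. moment n (walk p m z))"
      using integrable_Re[OF integrable_walk[OF adm, of m z]] by (simp add: funpow_transfer_harmonic_0)
  qed
  also have "\<dots> = moment_sum n * moment m z"
    by (simp add: moment_def)
  finally show ?thesis .
qed

lemma moment_sum_pos: "0 < moment_sum n"
  unfolding moment_sum_def by (intro add_pos_pos moment_pos) auto

text \<open>The multiples begin at \<open>Suc j\<close>: for the empty walk
  \<open>moment_sum 0\<close> is 2, so the bound would fail with exponent 0.\<close>

lemma moment_sum_mult_le: "moment_sum (Suc j * n) \<le> moment_sum n ^ Suc j"
proof (induction j)
  case (Suc j)
  have "moment_sum (Suc j * n + n) \<le> moment_sum n * moment_sum (Suc j * n)"
    using moment_add_le[of "Suc j * n" n 1] moment_add_le[of "Suc j * n" n \<i>]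
    by (simp add: moment_sum_def distrib_left)
  also have "\<dots> \<le> moment_sum n * moment_sum n ^ Suc j"
    by (intro mult_left_mono Suc less_imp_le moment_sum_pos)
  finally show ?case by (simp add: add.commute mult_ac)
qed simp

text \<open>Fekete's argument: along the multiples of n submultiplicativity bounds the growth rate
  by ln (\<open>moment_sum n\<close>) / n, while this subsequence still has limit L. The inequality
  holds at every n > 0, so at the critical radius exp (- L) all these terms of the series of
  \<open>moment_sum\<close> are at least 1.\<close>

lemma exp_le_moment_sum:
  assumes lim: "(\<lambda>n. 1 / real n * ln (moment n 1)) \<longlonglongrightarrow> L" and "n > 0"
  shows "exp (real n * L) \<le> moment_sum n"
proof -
  have "filterlim (\<lambda>j. Suc j * n) at_top at_top"
    by (rule filterlim_subseq) (use assms(2) in \<open>auto simp: strict_mono_def\<close>)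
  then have lim_sub: "(\<lambda>j. 1 / real (Suc j * n) * ln (moment (Suc j * n) 1)) \<longlonglongrightarrow> L"
    by (rule filterlim_compose[OF lim])
  have "1 / real (Suc j * n) * ln (moment (Suc j * n) 1) \<le> ln (moment_sum n) / real n" for j
  proof -
    have "moment (Suc j * n) 1 \<le> moment_sum n ^ Suc j"
      using moment_sum_mult_le[of j n] moment_pos[of \<i> "Suc j * n"]
      unfolding moment_sum_def[of "Suc j * n"] by simp
    then have "ln (moment (Suc j * n) 1) \<le> ln (moment_sum n ^ Suc j)"
      using moment_pos[of 1 "Suc j * n"] moment_sum_pos[of n] by (subst ln_le_cancel_iff) auto
    also have "\<dots> = real (Suc j) * ln (moment_sum n)"
      using moment_sum_pos[of n] by (simp add: ln_realpow del: of_nat_Suc power_Suc)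
    finally have "1 / real (Suc j * n) * ln (moment (Suc j * n) 1)
        \<le> 1 / real (Suc j * n) * (real (Suc j) * ln (moment_sum n))"
      by (rule mult_left_mono) simp
    also have "\<dots> = ln (moment_sum n) / real n"
      unfolding of_nat_mult by (simp del: of_nat_Suc)
    finally show ?thesis .
  qed
  then have "L \<le> ln (moment_sum n) / real n"
    by (intro LIMSEQ_le_const2[OF lim_sub]) blast
  then have "real n * L \<le> ln (moment_sum n)"
    using assms(2) by (simp add: field_simps)
  then show ?thesis
    using moment_sum_pos[of n] by (simp add: ln_ge_iff)
qed

lemma summable_moment:
  assumes lim: "(\<lambda>n. 1 / real n * ln (moment n z)) \<longlonglongrightarrow> L" and "z \<noteq> 0" "0 < r" "r < exp (- L)"
  shows "summable (\<lambda>n. r ^ n * moment n z)"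
proof -
  have "ln r < - L"
    using assms(3,4) by (metis exp_gt_zero ln_exp ln_less_cancel_iff)
  \<comment> \<open>A rate strictly between L and - ln r gives r exp m < 1, hence a dominating
    geometric series.\<close>
  then obtain m where m: "L < m" "m < - ln r"
    using dense[of L "- ln r"] by auto
  have "\<forall>\<^sub>F n in sequentially. 1 / real n * ln (moment n z) < m"
    using lim m(1) by (rule order_tendstoD)
  then have ev: "\<forall>\<^sub>F n in sequentially. norm (r ^ n * moment n z) \<le> (r * exp m) ^ n"
    using eventually_gt_at_top[of 0]
  proof eventually_elim
    case (elim n)
    have "ln (moment n z) \<le> real n * m"
      using elim by (simp add: field_simps)
    then have "exp (ln (moment n z)) \<le> exp (real n * m)"
      by simp
    then have "moment n z \<le> exp m ^ n"
      using moment_pos[OF assms(2), of n] by (simp add: exp_of_nat_mult)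
    then show ?case
      using assms(3) moment_pos[OF assms(2), of n] by (simp add: power_mult_distrib mult_left_mono)
  qed
  have "exp (ln r + m) < 1"
    using m(2) by simp
  then have "r * exp m < 1"
    using assms(3) by (simp add: exp_add)
  then have "summable (\<lambda>n. (r * exp m) ^ n)"
    using assms(3) by (intro summable_geometric) auto
  then show ?thesis
    using ev by (rule summable_comparison_test_ev[rotated])
qed

section \<open>Dyson--Schmidt recurrence for the coefficients\<close>

lemma norm_coeff_le: "cmod (coeff n k) \<le> moment_sum n"
  unfolding coeff_def moment_sum_def
  by (intro order_trans[OF norm_triangle_ineq] add_mono norm_funpow_transfer_harmonic_le)

lemma coeff_0: "coeff n 0 = of_real (moment_sum n)"
  by (simp add: coeff_def moment_sum_def funpow_transfer_harmonic_0)

lemma coeff_minus: "coeff n (- k) = cnj (coeff n k)"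
  unfolding coeff_def integral_walk[OF admissible_harmonic, symmetric] cnj_harmonic[symmetric]
    Bochner_Integration.integral_cnj complex_cnj_add ..

text \<open>Apply n further transfers to the resolvent identity and expand the generator: level n +
  1 carries the three-term side, level n the factor \<chi>(k).\<close>

lemma transfer_recurrence:
  defines "A \<equiv> \<lambda>n k. (transfer ^^ n) (harmonic (2*l) k)"
  shows "A (Suc n) k z + \<i> / (2 * of_real \<rho>) * ((of_int k - of_real l) * A (Suc n) (k + 1) z
      + 2 * of_int k * A (Suc n) k z + (of_int k + of_real l) * A (Suc n) (k - 1) z)
    = char K (of_int k) * A n k z"
proof -
  let ?W = "walk_law (Suc n)"
  let ?\<phi> = "\<lambda>z. harmonic (2*l) k z - flow_deriv l k z / \<rho>"
  define H where "H j p = harmonic (2*l) j (walk p (Suc n) z)" for j p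
  have A: "A m j y = (\<integral>p. harmonic (2*l) j (walk p m y) \<partial>walk_law m)" for m j y
    unfolding A_def by (rule integral_walk[OF admissible_harmonic, symmetric])
  have AH: "A (Suc n) j z = (\<integral>p. H j p \<partial>?W)" for j
    unfolding H_def by (rule A)
  have int: "integrable ?W (H j)" for j
    unfolding H_def by (rule integrable_walk[OF admissible_harmonic])
  have adm: "admissible ?\<phi>"
    by (intro admissible_diff admissible_harmonic admissible_divide admissible_flow_deriv)
  have "transfer ?\<phi> = (\<lambda>z. char K (of_int k) * harmonic (2*l) k z)"
    by (rule ext) (rule transfer_resolvent)
  then have "(transfer ^^ Suc n) ?\<phi> z = (transfer ^^ n) (\<lambda>z. char K (of_int k) * harmonic (2*l) k z) z"
    by (simp add: funpow_Suc_right del: funpow.simps)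
  also have "\<dots> = char K (of_int k) * A n k z"
    unfolding A integral_walk[OF admissible_mult[OF admissible_harmonic], symmetric] by simp
  also have "(transfer ^^ Suc n) ?\<phi> z = (\<integral>p. H k p - \<i> / 2 * ((of_real l - of_int k) * H (k + 1) p
     - 2 * of_int k * H k p - (of_real l + of_int k) * H (k - 1) p) / \<rho> \<partial>?W)"
    unfolding integral_walk[OF adm, symmetric] by (simp only: H_def flow_deriv_def)
  also have "\<dots> = A (Suc n) k z - \<i> / 2 * ((of_real l - of_int k) * A (Suc n) (k + 1) z
     - 2 * of_int k * A (Suc n) k z - (of_real l + of_int k) * A (Suc n) (k - 1) z) / \<rho>"
    unfolding AH using int by simp
  also have "\<dots> = A (Suc n) k z + \<i> / (2 * of_real \<rho>) * ((of_int k - of_real l) * A (Suc n) (k + 1) z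
      + 2 * of_int k * A (Suc n) k z + (of_int k + of_real l) * A (Suc n) (k - 1) z)"
  proof -
    have "x - \<i> / 2 * ((m - j) * a - 2 * j * b - (m + j) * c) / r
        = x + \<i> / (2 * r) * ((j - m) * a + 2 * j * b + (j + m) * c)"
      if "r \<noteq> 0" for x m j a b c r :: complex
      using that by (simp add: field_simps)
    then show ?thesis using \<rho>_pos by simp
  qed
  finally show ?thesis .
qed

lemma coeff_recurrence:
  "coeff (Suc n) k + \<i> / (2 * of_real \<rho>) * ((of_int k - of_real l) * coeff (Suc n) (k + 1)
      + 2 * of_int k * coeff (Suc n) k + (of_int k + of_real l) * coeff (Suc n) (k - 1))
    = char K (of_int k) * coeff n k"
proof -
  have alg: "(x + y) + a * (b * (x1 + y1) + c * (x + y) + d * (x2 + y2))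
      = (x + a * (b * x1 + c * x + d * x2)) + (y + a * (b * y1 + c * y + d * y2))"
    for x y a b c d x1 y1 x2 y2 :: complex
    by (simp add: algebra_simps)
  show ?thesis
    unfolding coeff_def alg transfer_recurrence by (rule distrib_left[symmetric])
qed

text \<open>Here f is the generating series over the levels n + 1, divided by its value
  \<open>D\<close> at k = 0, and \<eta> is the level-0 coefficient divided by \<open>D\<close>. The
  error is small because \<open>D\<close> is large when r is close to the critical radius.\<close>

lemma perturbed_dyson_schmidt:
  assumes lim: "\<And>z. z \<noteq> 0 \<Longrightarrow> (\<lambda>n. 1 / real n * ln (moment n z)) \<longlonglongrightarrow> L" and \<epsilon>: "0 < \<epsilon>"
  shows "\<exists>(r::real) f \<eta>. \<bar>r - exp (- L)\<bar> < \<epsilon> \<and> f 0 = 1 \<and> (\<forall>k. cmod (f k) \<le> 1)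
    \<and> (\<forall>k. f (- k) = cnj (f k)) \<and> (\<forall>k. cmod (\<eta> k) \<le> \<epsilon>)
    \<and> (\<forall>k. f k + \<i> / (2 * of_real \<rho>) * ((of_int k - of_real l) * f (k + 1)
          + 2 * of_int k * f k + (of_int k + of_real l) * f (k - 1))
        = of_real r * char K (of_int k) * (f k + \<eta> k))"
proof -
  \<comment> \<open>Each of the first N terms of \<open>D\<close> will be at least 1/2, so D \<ge>
    N/2, and N makes this at least \<open>moment_sum 0 / \<epsilon>\<close>. In
    \<open>\<delta>\<close> the first entry keeps N \<delta> \<le> 1/2, as Bernoulli's inequality
    requires, and the second keeps r within \<epsilon> of exp (- L).\<close>
  define N :: nat where "N = nat \<lceil>2 * moment_sum 0 / \<epsilon>\<rceil> + 1"
  define \<delta> where "\<delta> = min (1 / (2 * real N)) (\<epsilon> / (2 * exp (- L)))"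
  define r where "r = exp (- L) * (1 - \<delta>)"
  have N: "1 \<le> real N" "2 * moment_sum 0 / \<epsilon> \<le> real N"
    unfolding N_def by linarith+
  have \<delta>: "0 < \<delta>" "real N * \<delta> \<le> 1/2" "exp (- L) * \<delta> < \<epsilon>"
  proof -
    show "0 < \<delta>" using N(1) \<epsilon> by (simp add: \<delta>_def)
    have "\<delta> \<le> 1 / (2 * real N)" by (simp add: \<delta>_def)
    then show "real N * \<delta> \<le> 1/2" using N(1) by (simp add: field_simps)
    have "\<delta> \<le> \<epsilon> / (2 * exp (- L))" by (simp add: \<delta>_def)
    then have "exp (- L) * \<delta> \<le> \<epsilon> / 2" by (simp add: field_simps)
    then show "exp (- L) * \<delta> < \<epsilon>" using \<epsilon> by linarith
  qed
  have \<delta>1: "\<delta> \<le> 1/2"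
    using \<delta>(2) mult_right_mono[OF N(1), of \<delta>] \<delta>(1) by linarith
  have r: "0 < r" "r < exp (- L)" "\<bar>r - exp (- L)\<bar> < \<epsilon>"
    using \<delta> \<delta>1 by (auto simp: r_def algebra_simps)
  have sum0: "summable (\<lambda>n. r ^ n * moment_sum n)"
    using summable_add[OF summable_moment[OF lim[of 1] _ r(1,2)] summable_moment[OF lim[of \<i>] _ r(1,2)]]
    by (simp add: moment_sum_def algebra_simps)
  define a where "a n k = of_real (r ^ n) * coeff n k" for n k
  have norm_a: "cmod (a n k) \<le> r ^ n * moment_sum n" for n k
    using norm_coeff_le r(1) by (simp add: a_def norm_mult norm_power mult_left_mono)
  have summ: "summable (\<lambda>n. a n k)" for k
    by (rule summable_comparison_test'[OF sum0, of 0]) (rule norm_a)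
  have summS: "summable (\<lambda>n. a (Suc n) k)" for k
    using summ by (subst summable_Suc_iff)
  define D where "D = (\<Sum>n. r ^ Suc n * moment_sum (Suc n))"
  have sumD: "summable (\<lambda>n. r ^ Suc n * moment_sum (Suc n))"
    using sum0 by (subst summable_Suc_iff)
  define S where "S k = (\<Sum>n. a (Suc n) k)" for k
  have D_ge: "moment_sum 0 / \<epsilon> \<le> D"
  proof -
    have "r * exp L = 1 - \<delta>"
      by (simp add: r_def exp_minus field_simps)
    then have "(r * exp L) ^ N = (1 - \<delta>) ^ N"
      by simp
    also have "\<dots> \<ge> 1 + real N * (- \<delta>)"
      using Bernoulli_inequality[of "- \<delta>" N] \<delta>1 by simp
    finally have half: "1/2 \<le> (r * exp L) ^ N"
      using \<delta>(2) by linarith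
    have x1: "r * exp L \<le> 1" "0 < r * exp L"
      using r by (simp_all add: exp_minus field_simps)
    have "real N * (1/2) = (\<Sum>n<N. 1/2)" by simp
    also have "\<dots> \<le> (\<Sum>n<N. r ^ Suc n * moment_sum (Suc n))"
    proof (intro sum_mono)
      fix n assume "n \<in> {..<N}"
      then have "(r * exp L) ^ N \<le> (r * exp L) ^ Suc n"
        using x1 by (intro power_decreasing) auto
      with half have "1/2 \<le> (r * exp L) ^ Suc n" by linarith
      also have "\<dots> = r ^ Suc n * exp (real (Suc n) * L)"
        by (simp only: power_mult_distrib exp_of_nat_mult)
      also have "\<dots> \<le> r ^ Suc n * moment_sum (Suc n)"
        using r(1) by (intro mult_left_mono exp_le_moment_sum lim) auto
      finally show "1/2 \<le> r ^ Suc n * moment_sum (Suc n)" .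
    qed
    also have "\<dots> \<le> D"
      unfolding D_def using sumD r(1) by (intro sum_le_suminf) (auto intro!: mult_nonneg_nonneg less_imp_le[OF moment_sum_pos])
    finally show ?thesis using N(2) by simp
  qed
  have D_pos: "0 < D"
    using D_ge moment_sum_pos[of 0] \<epsilon> by (meson divide_pos_pos less_le_trans)
  have S0: "S 0 = of_real D"
    unfolding S_def D_def a_def coeff_0 of_real_mult[symmetric] using sumD by (simp only: suminf_of_real)
  have S_le: "cmod (S k) \<le> D" for k
  proof -
    have sn: "summable (\<lambda>n. cmod (a (Suc n) k))"
      by (rule summable_comparison_test'[OF sumD, of 0]) (use norm_a[of "Suc _" k] in simp)
    then have "cmod (S k) \<le> (\<Sum>n. cmod (a (Suc n) k))"
      unfolding S_def by (rule summable_norm)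
    also have "\<dots> \<le> D"
      unfolding D_def by (intro suminf_le norm_a sn sumD)
    finally show ?thesis .
  qed
  have S_minus: "S (- k) = cnj (S k)" for k
  proof -
    have "(\<lambda>n. cnj (a (Suc n) k)) sums cnj (S k)"
      unfolding S_def sums_cnj by (rule summable_sums[OF summS])
    then show ?thesis
      by (simp add: S_def a_def coeff_minus sums_iff)
  qed
  \<comment> \<open>After multiplication by r^(n+1) and summation, the left side starts at level 1
    but the right side at level 0; the additional term \<open>coeff 0 k\<close> becomes the
    error.\<close>
  have rec: "S k + \<i> / (2 * of_real \<rho>) * ((of_int k - of_real l) * S (k + 1)
        + 2 * of_int k * S k + (of_int k + of_real l) * S (k - 1))
      = of_real r * char K (of_int k) * (S k + coeff 0 k)" for k
  proof -
    have "a (Suc n) k + \<i> / (2 * of_real \<rho>) * ((of_int k - of_real l) * a (Suc n) (k + 1)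
        + 2 * of_int k * a (Suc n) k + (of_int k + of_real l) * a (Suc n) (k - 1))
      = of_real r * char K (of_int k) * a n k" for n
    proof -
      have "s * x + c * (u * (s * y) + v * (s * x) + w * (s * z)) = s * (x + c * (u * y + v * x + w * z))"
        for s x c u v w y z :: complex
        by (simp add: algebra_simps)
      then show ?thesis
        unfolding a_def by (simp only: coeff_recurrence) simp
    qed
    moreover have "(\<lambda>n. a (Suc n) j) sums S j" for j
      unfolding S_def by (rule summable_sums[OF summS])
    then have "(\<lambda>n. a (Suc n) k + \<i> / (2 * of_real \<rho>) * ((of_int k - of_real l) * a (Suc n) (k + 1)
        + 2 * of_int k * a (Suc n) k + (of_int k + of_real l) * a (Suc n) (k - 1))) sums (S k + \<i> / (2 * of_real \<rho>) *
        ((of_int k - of_real l) * S (k + 1) + 2 * of_int k * S k + (of_int k + of_real l) * S (k - 1)))"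
      by (intro sums_add sums_mult)
    ultimately have "(\<lambda>n. of_real r * char K (of_int k) * a n k) sums (S k + \<i> / (2 * of_real \<rho>) *
        ((of_int k - of_real l) * S (k + 1) + 2 * of_int k * S k + (of_int k + of_real l) * S (k - 1)))"
      by (simp only:)
    moreover have "(\<lambda>n. a n k) sums (S k + a 0 k)"
      using summable_sums[OF summS, of k] unfolding S_def by (subst (asm) sums_Suc_iff) simp
    then have "(\<lambda>n. of_real r * char K (of_int k) * a n k) sums (of_real r * char K (of_int k) * (S k + a 0 k))"
      by (rule sums_mult)
    ultimately show ?thesis
      using sums_unique2 by (fastforce simp: a_def)
  qed
  show ?thesis
  proof (rule exI[of _ r], rule exI[of _ "\<lambda>k. S k / D"], rule exI[of _ "\<lambda>k. coeff 0 k / D"], intro conjI allI)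
    show "cmod (coeff 0 k / of_real D) \<le> \<epsilon>" for k
    proof -
      have "cmod (coeff 0 k) \<le> moment_sum 0" by (rule norm_coeff_le)
      also have "\<dots> \<le> D * \<epsilon>" using D_ge \<epsilon> by (simp add: field_simps)
      finally show ?thesis using D_pos by (simp add: norm_divide field_simps)
    qed
    show "S k / of_real D + \<i> / (2 * of_real \<rho>) * ((of_int k - of_real l) * (S (k + 1) / of_real D)
        + 2 * of_int k * (S k / of_real D) + (of_int k + of_real l) * (S (k - 1) / of_real D))
      = of_real r * char K (of_int k) * (S k / of_real D + coeff 0 k / of_real D)" for k
    proof -
      have lin: "x / d + a * (b * (y / d) + c * (x / d) + e * (z / d)) = (x + a * (b * y + c * x + e * z)) / d"
        for x y z a b c d e :: complex
        by (simp add: add_divide_distrib distrib_left)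
      show ?thesis
        unfolding lin rec by (simp only: times_divide_eq_right add_divide_distrib[symmetric])
    qed
  qed (use r S0 S_le D_pos S_minus in \<open>auto simp: norm_divide\<close>)
qed

end

section \<open>Second-order perturbation of the Dyson--Schmidt equation\<close>

text \<open>Summing the discrete Wronskian \<open>f0 n * f (n + 1) - f n * f0 (n + 1)\<close> of a solution of the
  perturbed equation against the unperturbed one isolates \<open>f 1 - f0 1\<close>, because the Wronskian
  vanishes at infinity.\<close>

lemma casoratian_sums:
  fixes f0 f \<eta> c :: "int \<Rightarrow> complex" and \<rho> l r :: real
  assumes "\<rho> > 0" and f0: "f0 0 = 1" "(\<lambda>n. f0 (int n)) \<longlonglongrightarrow> 0"
    and f: "f 0 = 1" "\<And>k. cmod (f k) \<le> 1"
    and eq0: "\<And>k. f0 k + \<i> * of_int k / (2 * of_real \<rho>) * (f0 (k + 1) + 2 * f0 k + f0 (k - 1)) = c k * f0 k"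
    and eq: "\<And>k. f k + \<i> / (2 * of_real \<rho>) * ((of_int k - of_real l) * f (k + 1)
        + 2 * of_int k * f k + (of_int k + of_real l) * f (k - 1)) = of_real r * c k * (f k + \<eta> k)"
  shows "(\<lambda>k. f0 (int (Suc k)) / of_nat (Suc k) * (of_real l * (f (int k) - f (int k + 2))
      - 2 * \<i> * of_real \<rho> * c (int (Suc k)) * (of_real (1 - r) * f (int (Suc k)) - of_real r * \<eta> (int (Suc k)))))
    sums (f 1 - f0 1)"
proof -
  define W where "W n = f0 (int n) * f (int n + 1) - f (int n) * f0 (int n + 1)" for n
  have "(\<lambda>n. f0 (int n) * f (int n + 1)) \<longlonglongrightarrow> 0"
    by (rule Lim_null_comparison[OF _ tendsto_norm_zero[OF f0(2)]])
       (auto simp: norm_mult f(2) intro!: mult_left_le always_eventually)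
  moreover have "(\<lambda>n. f (int n) * f0 (int n + 1)) \<longlonglongrightarrow> 0"
    by (rule Lim_null_comparison[OF _ tendsto_norm_zero[OF LIMSEQ_Suc[OF f0(2)]]])
       (auto simp: norm_mult f(2) add.commute intro!: mult_left_le_one_le always_eventually)
  ultimately have "W \<longlonglongrightarrow> 0 - 0"
    unfolding W_def by (rule tendsto_diff)
  then have "(\<lambda>k. W k - W (Suc k)) sums (W 0 - 0)"
    by (intro telescope_sums') simp
  moreover have "W 0 - 0 = f 1 - f0 1"
    by (simp add: W_def f f0)
  moreover have "W k - W (Suc k) = f0 (int (Suc k)) / of_nat (Suc k) * (of_real l * (f (int k) - f (int k + 2))
      - 2 * \<i> * of_real \<rho> * c (int (Suc k)) * (of_real (1 - r) * f (int (Suc k)) - of_real r * \<eta> (int (Suc k))))" for k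
  proof -
    \<comment> \<open>Multiply the unperturbed equation by y1, the perturbed one by x1, and
      subtract. The diagonal terms of the two left sides cancel, leaving n times the increment of
      the Wronskian and the corrections in m, s and h.\<close>
    have gen: "x0 * y1 - y0 * x1 - (x1 * y2 - y1 * x2) = x1 / n * (m * (y0 - y2)
        - 2 * \<i> * R * C * ((1 - s) * y1 - s * h))"
      if "n \<noteq> 0" "R \<noteq> 0" and e0: "x1 + \<i> * n / (2 * R) * (x2 + 2 * x1 + x0) = C * x1"
        and e: "y1 + \<i> / (2 * R) * ((n - m) * y2 + 2 * n * y1 + (n + m) * y0) = s * C * (y1 + h)"
      for x0 x1 x2 y0 y1 y2 n m R C s h :: complex
    proof -
      have e0': "2 * R * x1 + \<i> * n * (x2 + 2 * x1 + x0) = 2 * R * (C * x1)"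
        using e0 that(2) by (simp add: field_simps)
      have e': "2 * R * y1 + \<i> * ((n - m) * y2 + 2 * n * y1 + (n + m) * y0) = 2 * R * (s * C * (y1 + h))"
        using e that(2) by (simp add: field_simps)
      have "\<i> * (n * (x0 * y1 - y0 * x1 - (x1 * y2 - y1 * x2)))
          = y1 * (2 * R * x1 + \<i> * n * (x2 + 2 * x1 + x0))
            - x1 * (2 * R * y1 + \<i> * ((n - m) * y2 + 2 * n * y1 + (n + m) * y0)) + \<i> * m * x1 * (y0 - y2)"
        by (simp add: algebra_simps)
      also have "\<dots> = \<i> * (x1 * (m * (y0 - y2) - 2 * \<i> * R * C * ((1 - s) * y1 - s * h)))"
        unfolding e0' e' by (simp add: algebra_simps)
      finally have "n * (x0 * y1 - y0 * x1 - (x1 * y2 - y1 * x2))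
          = x1 * (m * (y0 - y2) - 2 * \<i> * R * C * ((1 - s) * y1 - s * h))"
        by (simp only: mult_cancel_left complex_i_not_zero simp_thms)
      then show ?thesis using that(1) by (metis nonzero_mult_div_cancel_left times_divide_eq_left)
    qed
    have idx: "int (Suc k) + 1 = int k + 2" "int (Suc k) - 1 = int k" "int k + 1 = int (Suc k)"
      by auto
    show ?thesis
      unfolding W_def idx of_real_diff of_real_1
      by (rule gen[OF _ _ eq0[of "int (Suc k)", unfolded idx of_int_of_nat_eq]
            eq[of "int (Suc k)", unfolded idx of_int_of_nat_eq]])
         (use assms(1) in \<open>simp_all del: of_nat_Suc\<close>)
  qed
  ultimately show ?thesis by simp
qed

lemma summable_on_int_imp_summable_Suc:
  assumes "h summable_on (UNIV :: int set)" and "\<And>n. (0::real) \<le> h n"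
  shows "summable (\<lambda>k. h (int (Suc k)))"
proof -
  have "h summable_on range (\<lambda>k. int (Suc k))"
    by (rule summable_on_subset_banach[OF assms(1)]) auto
  then have "(h \<circ> (\<lambda>k. int (Suc k))) summable_on UNIV"
    by (subst (asm) summable_on_reindex) (auto simp: inj_def)
  then show ?thesis
    by (auto simp: o_def intro: summable_on_imp_summable)
qed

text \<open>At the exponents \<open>ls j\<close>, the numbers \<open>R j\<close> approximate
  \<lambda>(l), and \<open>F j\<close> solves the perturbed equation with error \<open>E j\<close>.
  Its cubic size lets the error vanish even after two divisions by \<open>ls j\<close>. The
  summation index k stands for n = k + 1.\<close>

lemma second_order_expansion:
  fixes f0 :: "int \<Rightarrow> complex" and F E :: "nat \<Rightarrow> int \<Rightarrow> complex"
    and ls R :: "nat \<Rightarrow> real" and ch :: "real \<Rightarrow> complex" and \<rho> \<kappa>1 \<kappa>2 :: real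
  assumes \<rho>: "\<rho> > 0" and sol: "dyson_schmidt_solution \<rho> ch f0"
    and ch: "\<And>x. cmod (ch x) \<le> 1" "ch 0 = 1"
    and ls: "\<And>j. 0 < ls j" "\<And>j. ls j \<le> 1/2" "ls \<longlonglongrightarrow> 0"
    and R1: "(\<lambda>j. (R j - 1) / ls j) \<longlonglongrightarrow> \<kappa>1"
    and R2: "(\<lambda>j. ((R j - 1) / ls j - \<kappa>1) / ls j) \<longlonglongrightarrow> \<kappa>2"
    and F: "\<And>j. F j 0 = 1" "\<And>j k. cmod (F j k) \<le> 1" "\<And>j k. F j (- k) = cnj (F j k)"
    and E: "\<And>j k. cmod (E j k) \<le> ls j ^ 3"
    and eq: "\<And>j k. F j k + \<i> / (2 * of_real \<rho>) * ((of_int k - of_real (ls j)) * F j (k + 1)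
        + 2 * of_int k * F j k + (of_int k + of_real (ls j)) * F j (k - 1))
      = of_real (R j) * ch (of_int k) * (F j k + E j k)"
  shows "\<kappa>1 = 1 / \<rho> * Im (f0 1)"
    and "summable (\<lambda>k. ch (real (Suc k)) / of_nat (Suc k) * (f0 (int (Suc k)))\<^sup>2)"
    and "summable (\<lambda>k. 1 / of_nat (Suc k * (Suc k + 1)) * f0 (int (Suc k)) * f0 (int (Suc k) + 1))"
    and "\<kappa>2 = 1 / \<rho> * Im (f0 1
           + 2 * \<i> * complex_of_real \<rho> * complex_of_real \<kappa>1
               * (\<Sum>k. ch (real (Suc k)) / of_nat (Suc k) * (f0 (int (Suc k)))\<^sup>2)
           - (\<Sum>k. 1 / of_nat (Suc k * (Suc k + 1)) * f0 (int (Suc k)) * f0 (int (Suc k) + 1)))"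
proof -
  have f00: "f0 0 = 1"
    and sq: "(\<lambda>n. (cmod (f0 n))\<^sup>2) summable_on UNIV"
    and lim: "(f0 \<longlongrightarrow> 0) cofinite"
    and eq0: "\<And>k. f0 k + \<i> * of_int k / (2 * of_real \<rho>) * (f0 (k + 1) + 2 * f0 k + f0 (k - 1)) = ch (of_int k) * f0 k"
    using sol by (auto simp: dyson_schmidt_solution_def dyson_schmidt_def)
  have lim_nat: "(\<lambda>n. f0 (int n)) \<longlonglongrightarrow> 0"
  proof (rule filterlim_compose[OF lim])
    show "filterlim int cofinite sequentially"
      unfolding cofinite_eq_sequentially[symmetric] filterlim_iff eventually_cofinite
    proof (intro allI impI)
      fix P :: "int \<Rightarrow> bool" assume "finite {x. \<not> P x}"
      from finite_vimageI[OF this inj_of_nat] show "finite {n. \<not> P (int n)}"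
        by (simp add: vimage_def)
    qed
  qed
  define a where "a k = f0 (int (Suc k)) / of_nat (Suc k)" for k
  \<comment> \<open>Through xy \<le> x^2 + y^2, square summability of f0(n) and of 1/n yields a
    summable majorant of f0(n)/n.\<close>
  define M where "M k = (cmod (f0 (int (Suc k))))\<^sup>2 + 1 / (real (Suc k))\<^sup>2" for k
  have "summable (\<lambda>k. 1 / (real (Suc k))\<^sup>2)"
    using inverse_power_summable[of 2, where ?'a = real]
    by (subst summable_Suc_iff) (simp add: field_simps)
  then have summM: "summable M"
    unfolding M_def
    by (intro summable_add summable_on_int_imp_summable_Suc[OF sq]) auto
  have a_le: "cmod (a k) \<le> M k" for k
  proof -
    have "cmod (a k) = cmod (f0 (int (Suc k))) * (1 / real (Suc k))"
      unfolding a_def norm_divide norm_of_nat by simp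
    also have "\<dots> \<le> (cmod (f0 (int (Suc k))))\<^sup>2 + (1 / real (Suc k))\<^sup>2"
    proof -
      have xy: "x * y \<le> x\<^sup>2 + y\<^sup>2" if "0 \<le> x" "0 \<le> y" for x y :: real
        using sum_squares_bound[of x y] mult_nonneg_nonneg[OF that] by linarith
      show ?thesis by (intro xy) auto
    qed
    finally show ?thesis by (simp add: M_def power_divide del: of_nat_Suc)
  qed
  have M_nonneg: "0 \<le> M k" for k
    by (simp add: M_def)
  define q where "q j = (R j - 1) / ls j" for j
  define e where "e j k = E j k / of_real (ls j)" for j k
  have R_eq: "R j = 1 + ls j * q j" for j
    using ls(1)[of j] by (simp add: q_def)
  have qlim: "q \<longlonglongrightarrow> \<kappa>1"
    using R1 by (simp add: q_def[abs_def])
  have Rlim: "R \<longlonglongrightarrow> 1"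
  proof -
    have "(\<lambda>j. 1 + ls j * q j) \<longlonglongrightarrow> 1 + 0 * \<kappa>1"
      by (intro tendsto_intros ls(3) qlim)
    then show ?thesis by (simp flip: R_eq)
  qed
  have e_le: "cmod (e j k) \<le> ls j ^ 2" for j k
    using E[of j k] ls(1)[of j] by (simp add: e_def norm_divide divide_simps power3_eq_cube power2_eq_square)
  have elim: "(\<lambda>j. e j k) \<longlonglongrightarrow> 0" for k
    by (rule Lim_null_comparison[OF always_eventually[OF allI[OF e_le]]])
       (use tendsto_power[OF ls(3), of 2] in simp)
  have Elim: "(\<lambda>j. E j k) \<longlonglongrightarrow> 0" for k
    by (rule Lim_null_comparison[OF always_eventually[OF allI[OF E]]])
       (use tendsto_power[OF ls(3), of 3] in simp)
  \<comment> \<open>Terms of the Wronskian series divided by \<open>ls j\<close>. Both 1 -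
    \<open>R j\<close> and \<open>E j\<close> contain this factor, leaving \<open>q\<close> and
    \<open>e\<close>, so nothing blows up as \<open>ls j\<close> tends to 0.\<close>
  define t where "t k j = a k * ((F j (int k) - F j (int k + 2))
      + 2 * \<i> * of_real \<rho> * ch (real (Suc k)) * (of_real (q j) * F j (int (Suc k)) + of_real (R j) * e j (int (Suc k))))" for k j
  have tsums: "(\<lambda>k. t k j) sums ((F j 1 - f0 1) / of_real (ls j))" for j
  proof -
    have "(\<lambda>k. f0 (int (Suc k)) / of_nat (Suc k) * (of_real (ls j) * (F j (int k) - F j (int k + 2))
      - 2 * \<i> * of_real \<rho> * ch (of_int (int (Suc k))) * (of_real (1 - R j) * F j (int (Suc k))
        - of_real (R j) * E j (int (Suc k))))) sums (F j 1 - f0 1)"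
      by (rule casoratian_sums[OF \<rho> f00 lim_nat F(1) F(2) eq0 eq])
    from sums_divide[OF this, of "of_real (ls j)"] show ?thesis
    proof (rule sums_cong[THEN iffD1, rotated])
      fix k
      have Eje: "E j (int (Suc k)) = of_real (ls j) * e j (int (Suc k))"
        using ls(1)[of j] by (simp add: e_def)
      have "x * (s * y - c * (w * f - r * (s * g))) / s = x * (y + c * (p * f + r * g))"
        if "s \<noteq> 0" "w = - (s * p)" for x y c w f r s g p :: complex
        using that by (simp add: field_simps)
      then show "f0 (int (Suc k)) / of_nat (Suc k) * (of_real (ls j) * (F j (int k) - F j (int k + 2))
        - 2 * \<i> * of_real \<rho> * ch (of_int (int (Suc k))) * (of_real (1 - R j) * F j (int (Suc k))
        - of_real (R j) * E j (int (Suc k)))) / of_real (ls j) = t k j"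
        unfolding t_def a_def Eje of_int_of_nat_eq
        by (rule) (use ls(1)[of j] in \<open>auto simp: R_eq\<close>)
    qed
  qed
  \<comment> \<open>Bounds uniform in j provide one majorant \<open>C * M k\<close> for the whole
    family of series.\<close>
  obtain B1 where B1: "\<And>j. \<bar>q j\<bar> \<le> B1"
    using convergent_imp_Bseq[OF convergentI[OF qlim]] by (metis BseqE real_norm_def)
  obtain B2 where B2: "\<And>j. \<bar>R j\<bar> \<le> B2"
    using convergent_imp_Bseq[OF convergentI[OF Rlim]] by (metis BseqE real_norm_def)
  define C where "C = 2 + 2 * \<rho> * (B1 + B2)"
  have t_le: "cmod (t k j) \<le> C * M k" for k j
  proof -
    have e1: "cmod (e j i) \<le> 1" for i
    proof -
      have "ls j ^ 2 \<le> 1" using ls(1,2)[of j] by (intro power_le_one) auto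
      then show ?thesis using e_le[of j i] by linarith
    qed
    have "cmod (of_real (q j) * F j (int (Suc k)) + of_real (R j) * e j (int (Suc k))) \<le> \<bar>q j\<bar> * 1 + \<bar>R j\<bar> * 1"
      by (rule order_trans[OF norm_triangle_ineq])
         (auto simp: norm_mult intro!: add_mono mult_left_le F(2) e1)
    also have "\<dots> \<le> B1 + B2" using B1[of j] B2[of j] by simp
    finally have b: "cmod (of_real (q j) * F j (int (Suc k)) + of_real (R j) * e j (int (Suc k))) \<le> B1 + B2" .
    have "cmod (2 * \<i> * of_real \<rho> * ch (real (Suc k)) * (of_real (q j) * F j (int (Suc k)) + of_real (R j) * e j (int (Suc k))))
        \<le> 2 * \<rho> * 1 * (B1 + B2)"
      unfolding norm_mult using \<rho> ch(1)[of "real (Suc k)"] b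
      by (intro mult_mono) (auto simp: norm_mult simp del: of_nat_Suc)
    moreover have "cmod (F j (int k) - F j (int k + 2)) \<le> 1 + 1"
      by (rule order_trans[OF norm_triangle_ineq4]) (intro add_mono F(2))
    ultimately have "cmod (F j (int k) - F j (int k + 2)
      + 2 * \<i> * of_real \<rho> * ch (real (Suc k)) * (of_real (q j) * F j (int (Suc k)) + of_real (R j) * e j (int (Suc k)))) \<le> C"
      unfolding C_def by (intro order_trans[OF norm_triangle_ineq]) linarith
    from mult_mono[OF a_le[of k] this] M_nonneg[of k] show ?thesis
      unfolding t_def norm_mult[of "a k"] by (simp add: mult.commute)
  qed
  have summCM: "summable (\<lambda>k. C * M k)"
    using summM by (rule summable_mult)
  \<comment> \<open>The divided series is bounded uniformly in j, so \<open>F j 1\<close> differs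
    from \<open>f0 1\<close> by at most a constant multiple of \<open>ls j\<close>.\<close>
  have F1: "(\<lambda>j. F j 1) \<longlonglongrightarrow> f0 1"
  proof -
    have sumt: "cmod ((F j 1 - f0 1) / of_real (ls j)) \<le> (\<Sum>k. C * M k)" for j
    proof -
      have sn: "summable (\<lambda>k. cmod (t k j))"
        by (rule summable_comparison_test'[OF summCM, of 0]) (use t_le in simp)
      have "cmod (\<Sum>k. t k j) \<le> (\<Sum>k. cmod (t k j))"
        by (rule summable_norm[OF sn])
      also have "\<dots> \<le> (\<Sum>k. C * M k)"
        by (intro suminf_le t_le sn summCM)
      finally show ?thesis using tsums[of j] by (simp add: sums_iff)
    qed
    have "(\<lambda>j. F j 1 - f0 1) \<longlonglongrightarrow> 0"
    proof (rule Lim_null_comparison)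
      show "\<forall>\<^sub>F j in sequentially. cmod (F j 1 - f0 1) \<le> ls j * (\<Sum>k. C * M k)"
      proof (intro always_eventually allI)
        fix j
        have "cmod (F j 1 - f0 1) / ls j \<le> (\<Sum>k. C * M k)"
          using sumt[of j] ls(1)[of j] by (simp add: norm_divide)
        then show "cmod (F j 1 - f0 1) \<le> ls j * (\<Sum>k. C * M k)"
          using ls(1)[of j] by (simp add: pos_divide_le_eq mult.commute)
      qed
      show "(\<lambda>j. ls j * (\<Sum>k. C * M k)) \<longlonglongrightarrow> 0"
        using tendsto_mult_right[OF ls(3)] by simp
    qed
    then show ?thesis by (simp add: LIM_zero_iff)
  qed
  \<comment> \<open>The equation at k determines index k + 1 from k and k - 1, hence the induction
    over neighbouring pairs. Solving it divides by k - \<open>ls j\<close>, which is nonzero because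
    k \<ge> 1 and \<open>ls j\<close> \<le> 1/2.\<close>
  have Flim2: "(\<lambda>j. F j (int n)) \<longlonglongrightarrow> f0 (int n) \<and> (\<lambda>j. F j (int (Suc n))) \<longlonglongrightarrow> f0 (int (Suc n))" for n
  proof (induction n)
    case 0
    show ?case using F1 by (simp add: F(1) f00)
  next
    case (Suc n)
    define k where "k = int (Suc n)"
    have k: "k + 1 = int (Suc (Suc n))" "k - 1 = int n" "real_of_int k \<ge> 1"
      by (auto simp: k_def)
    have c0: "complex_of_int k - of_real (ls j) \<noteq> 0" for j
    proof
      assume "complex_of_int k - of_real (ls j) = 0"
      from arg_cong[OF this, of Re] have "real_of_int k = ls j" by simp
      then show False using ls(2)[of j] k(3) by linarith
    qed
    have solve: "x = ((r * (y + h) - y) * (2 * R / \<i>) - 2 * n * y - v * z) / u"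
      if "y + \<i> / (2 * R) * (u * x + 2 * n * y + v * z) = r * (y + h)" "u \<noteq> 0" "R \<noteq> 0"
      for x y z r h R u v n :: complex
    proof -
      have "(y + \<i> / (2 * R) * X - y) * (2 * R / \<i>) = X" for X
        using that(3) by (simp add: field_simps)
      then have "(r * (y + h) - y) * (2 * R / \<i>) = u * x + 2 * n * y + v * z"
        unfolding that(1)[symmetric] .
      then show ?thesis using that(2) by simp
    qed
    have "F j (k + 1) = ((of_real (R j) * ch (of_int k) * (F j k + E j k) - F j k) * (2 * of_real \<rho> / \<i>)
        - 2 * of_int k * F j k - (of_int k + of_real (ls j)) * F j (k - 1)) / (of_int k - of_real (ls j))" for j
      by (rule solve[OF eq c0]) (use \<rho> in simp)
    moreover have "(\<lambda>j. ((of_real (R j) * ch (of_int k) * (F j k + E j k) - F j k) * (2 * of_real \<rho> / \<i>)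
        - 2 * of_int k * F j k - (of_int k + of_real (ls j)) * F j (k - 1)) / (of_int k - of_real (ls j)))
      \<longlonglongrightarrow> ((of_real 1 * ch (of_int k) * (f0 k + 0) - f0 k) * (2 * of_real \<rho> / \<i>)
        - 2 * of_int k * f0 k - (of_int k + of_real 0) * f0 (k - 1)) / (of_int k - of_real 0)"
      using Suc k(3) unfolding k(2) k_def[symmetric]
      by (intro tendsto_intros Rlim Elim ls(3)) auto
    moreover have "f0 (k + 1) = ((of_real 1 * ch (of_int k) * (f0 k + 0) - f0 k) * (2 * of_real \<rho> / \<i>)
        - 2 * of_int k * f0 k - (of_int k + of_real 0) * f0 (k - 1)) / (of_int k - of_real 0)"
    proof (rule solve)
      have regroup: "\<i> * n / d * (x + 2 * y + z) = \<i> / d * ((n - of_real 0) * x + 2 * n * y + (n + of_real 0) * z)"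
        for n d x y z :: complex
        unfolding divide_inverse by (simp add: algebra_simps)
      show "f0 k + \<i> / (2 * of_real \<rho>) * ((of_int k - of_real 0) * f0 (k + 1) + 2 * of_int k * f0 k
          + (of_int k + of_real 0) * f0 (k - 1)) = of_real 1 * ch (of_int k) * (f0 k + 0)"
        unfolding regroup[symmetric] of_real_1 mult_1 add_0_right by (rule eq0)
    qed (use \<rho> k(3) in auto)
    ultimately have "(\<lambda>j. F j (k + 1)) \<longlonglongrightarrow> f0 (k + 1)"
      by (simp only:)
    with Suc show ?case unfolding k(1) by blast
  qed
  then have Flim: "(\<lambda>j. F j (int n)) \<longlonglongrightarrow> f0 (int n)" for n
    by blast

  define t0 where "t0 k = a k * ((f0 (int k) - f0 (int k + 2))
      + 2 * \<i> * of_real \<rho> * ch (real (Suc k)) * (of_real \<kappa>1 * f0 (int (Suc k))))" for k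
  have tlim: "(\<lambda>j. t k j) \<longlonglongrightarrow> t0 k" for k
  proof -
    have "(\<lambda>j. F j (int k + 2)) \<longlonglongrightarrow> f0 (int k + 2)"
      using Flim[of "k + 2"] by (simp add: add.commute)
    then have "(\<lambda>j. t k j) \<longlonglongrightarrow> a k * ((f0 (int k) - f0 (int k + 2))
      + 2 * \<i> * of_real \<rho> * ch (real (Suc k)) * (of_real \<kappa>1 * f0 (int (Suc k)) + of_real 1 * 0))"
      unfolding t_def by (intro tendsto_intros Flim qlim Rlim elim)
    then show ?thesis by (simp add: t0_def)
  qed
  \<comment> \<open>Dominated convergence for series; the limit is the first-order correction to
    \<open>f0 1\<close>.\<close>
  have "(\<lambda>j. \<Sum>k. t k j) \<longlonglongrightarrow> (\<Sum>k. t0 k)"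
    using tannerys_theorem[OF tlim _ summCM] t_le by (simp add: always_eventually)
  then have dlim: "(\<lambda>j. (F j 1 - f0 1) / of_real (ls j)) \<longlonglongrightarrow> (\<Sum>k. t0 k)"
    using tsums by (simp add: sums_iff)

  \<comment> \<open>The equation at k = 0: since \<open>F j (- 1)\<close> is the conjugate of
    \<open>F j 1\<close> and \<chi>(0) = 1, it expresses \<open>R j\<close> through Im
    (\<open>F j 1\<close>) up to the error. Its limit gives \<open>\<kappa>1\<close>, its difference
    quotient \<open>\<kappa>2\<close>.\<close>
  have q_eq: "q j = 1 / \<rho> * Im (F j 1) - R j * Re (e j 0)" for j
  proof -
    have "\<i> / (2 * of_real \<rho>) * ((of_int 0 - of_real s) * z + 2 * of_int 0 * y + (of_int 0 + of_real s) * cnj z)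
        = of_real (s * (Im z / \<rho>))" for s y z
    proof -
      have conj: "cnj z - z = - (2 * \<i> * of_real (Im z))"
        by (simp add: complex_eq_iff)
      have lin: "(of_int 0 - of_real s) * z + 2 * of_int 0 * y + (of_int 0 + of_real s) * cnj z
          = of_real s * (cnj z - z)"
        by (simp add: algebra_simps)
      show ?thesis
        unfolding lin conj using \<rho> by (simp add: field_simps)
    qed
    then have "1 + of_real (ls j * (Im (F j 1) / \<rho>)) = of_real (R j) * (1 + E j 0)"
      using eq[of j 0] F(3)[of j 1] F(1)[of j] ch(2) by simp
    from arg_cong[OF this, of Re] have "1 + ls j * (Im (F j 1) / \<rho>) = R j * (1 + Re (E j 0))"
      by simp
    then have "R j - 1 = ls j * (Im (F j 1) / \<rho>) - R j * Re (E j 0)"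
      by (simp add: algebra_simps)
    then show ?thesis
      using ls(1)[of j] by (simp add: q_def e_def diff_divide_distrib)
  qed
  have "(\<lambda>j. 1 / \<rho> * Im (F j 1) - R j * Re (e j 0)) \<longlonglongrightarrow> 1 / \<rho> * Im (f0 1) - 1 * Re 0"
    by (intro tendsto_intros F1 Rlim elim)
  then have "q \<longlonglongrightarrow> 1 / \<rho> * Im (f0 1) - 1 * Re 0"
    unfolding q_eq[symmetric] .
  then show \<kappa>1: "\<kappa>1 = 1 / \<rho> * Im (f0 1)"
    using LIMSEQ_unique[OF qlim] by simp

  have e2: "(\<lambda>j. Re (e j 0) / ls j) \<longlonglongrightarrow> 0"
  proof (rule Lim_null_comparison[OF always_eventually[OF allI] ls(3)])
    fix j
    have "\<bar>Re (e j 0)\<bar> \<le> ls j * ls j"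
      using abs_Re_le_cmod[of "e j 0"] e_le[of j 0] by (simp add: power2_eq_square)
    then show "norm (Re (e j 0) / ls j) \<le> ls j"
      using ls(1)[of j] by (simp add: divide_simps)
  qed
  have "(q j - \<kappa>1) / ls j = 1 / \<rho> * Im ((F j 1 - f0 1) / of_real (ls j)) - R j * (Re (e j 0) / ls j)" for j
    unfolding q_eq \<kappa>1 by (simp add: diff_divide_distrib right_diff_distrib)
  then have "(\<lambda>j. (q j - \<kappa>1) / ls j) \<longlonglongrightarrow> 1 / \<rho> * Im (\<Sum>k. t0 k) - 1 * 0"
    by (simp only:) (intro tendsto_intros dlim Rlim e2)
  then have \<kappa>2: "\<kappa>2 = 1 / \<rho> * Im (\<Sum>k. t0 k)"
    using LIMSEQ_unique[OF R2] by (simp add: q_def)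

  \<comment> \<open>The bound by 1 passes from \<open>F j\<close> to its pointwise limit
    \<open>f0\<close>.\<close>
  have f0_le: "cmod (f0 (int n)) \<le> 1" for n
    by (rule tendsto_upperbound[OF tendsto_norm[OF Flim]]) (auto simp: F(2))
  show summ1: "summable (\<lambda>k. ch (real (Suc k)) / of_nat (Suc k) * (f0 (int (Suc k)))\<^sup>2)"
  proof (rule summable_comparison_test'[OF summM, of 0])
    fix k
    have "ch (real (Suc k)) / of_nat (Suc k) * (f0 (int (Suc k)))\<^sup>2 = a k * (ch (real (Suc k)) * f0 (int (Suc k)))"
      by (simp add: a_def power2_eq_square)
    also have "cmod \<dots> \<le> M k * (1 * 1)"
      unfolding norm_mult by (intro mult_mono a_le ch(1) f0_le M_nonneg mult_nonneg_nonneg) auto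
    finally show "cmod (ch (real (Suc k)) / of_nat (Suc k) * (f0 (int (Suc k)))\<^sup>2) \<le> M k" by simp
  qed
  define b where "b k = a k * f0 (int (Suc k) + 1)" for k
  define b' where "b' k = 1 / of_nat (Suc k * (Suc k + 1)) * f0 (int (Suc k)) * f0 (int (Suc k) + 1)" for k
  have summb: "summable b"
  proof (rule summable_comparison_test'[OF summM, of 0])
    fix k
    have "cmod (b k) \<le> M k * 1"
      unfolding b_def norm_mult using f0_le[of "k + 2"]
      by (intro mult_mono a_le M_nonneg) (auto simp: add.commute)
    then show "cmod (b k) \<le> M k" by simp
  qed
  \<comment> \<open>Partial fractions: with n = k + 1, 1/(n + 1) = 1/n - 1/(n(n + 1)). This compares
    the shifted product f0(n) f0(n + 1)/(n + 1) with \<open>b\<close>.\<close>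
  have bd: "a (Suc k) * f0 (int (Suc k)) = b k - b' k" for k
  proof -
    have fractions: "y / (n + 1) * x = x / n * y - 1 / (n * (n + 1)) * x * y" if "n \<noteq> 0" "n + 1 \<noteq> 0" for x y n :: complex
    proof -
      have parts: "1 / (n * (n + 1)) = 1 / n - 1 / (n + 1)"
        using that by (simp add: diff_frac_eq)
      show ?thesis unfolding parts by (simp add: algebra_simps)
    qed
    have idx: "int (Suc k) + 1 = int (Suc (Suc k))"
        "complex_of_nat (Suc (Suc k)) = of_nat (Suc k) + 1"
        "complex_of_nat (Suc k * (Suc k + 1)) = of_nat (Suc k) * (of_nat (Suc k) + 1)"
      by (simp_all add: algebra_simps)
    show ?thesis
      unfolding a_def b_def b'_def idx
      by (rule fractions) (simp_all only: of_nat_eq_0_iff nat.distinct not_False_eq_True flip: idx(2))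
  qed
  have summa: "summable (\<lambda>k. a k * f0 (int k))"
  proof (rule summable_comparison_test'[OF summM, of 0])
    fix k
    have "cmod (a k * f0 (int k)) \<le> M k * 1"
      unfolding norm_mult by (intro mult_mono a_le M_nonneg f0_le) auto
    then show "cmod (a k * f0 (int k)) \<le> M k" by simp
  qed
  then have summa': "summable (\<lambda>k. a (Suc k) * f0 (int (Suc k)))"
    by (subst summable_Suc_iff)
  have "b' = (\<lambda>k. b k - a (Suc k) * f0 (int (Suc k)))"
    by (rule ext, simp only: bd) simp
  then have summb': "summable b'"
    using summable_diff[OF summb summa'] by simp
  then show "summable (\<lambda>k. 1 / of_nat (Suc k * (Suc k + 1)) * f0 (int (Suc k)) * f0 (int (Suc k) + 1))"
    unfolding b'_def .
  \<comment> \<open>The head term is \<open>f0 1\<close> because \<open>f0 0\<close> = 1. The sum of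
    \<open>b\<close> will cancel against the one inside \<open>t0\<close>, so only the sum of
    \<open>b'\<close> survives.\<close>
  have a_sums: "(\<Sum>k. a k * f0 (int k)) = f0 1 + (suminf b - suminf b')"
    using suminf_split_head[OF summa] suminf_diff[OF summb summb']
    by (simp only: bd) (simp add: a_def f00)
  have cancel: "(x + (y - z)) - y + w = x + w - z" for x y z w :: complex
    by simp
  have "t0 k = a k * f0 (int k) - b k
      + 2 * \<i> * of_real \<rho> * of_real \<kappa>1 * (ch (real (Suc k)) / of_nat (Suc k) * (f0 (int (Suc k)))\<^sup>2)" for k
    by (simp add: t0_def a_def b_def power2_eq_square algebra_simps)
  then have "(\<Sum>k. t0 k) = (\<Sum>k. a k * f0 (int k)) - suminf b
      + 2 * \<i> * of_real \<rho> * of_real \<kappa>1 * (\<Sum>k. ch (real (Suc k)) / of_nat (Suc k) * (f0 (int (Suc k)))\<^sup>2)"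
    by (simp only: suminf_add[OF summable_diff[OF summa summb] summable_mult[OF summ1], symmetric]
         suminf_diff[OF summa summb, symmetric] suminf_mult[OF summ1])
  then show "\<kappa>2 = 1 / \<rho> * Im (f0 1
           + 2 * \<i> * complex_of_real \<rho> * complex_of_real \<kappa>1
               * (\<Sum>k. ch (real (Suc k)) / of_nat (Suc k) * (f0 (int (Suc k)))\<^sup>2)
           - (\<Sum>k. 1 / of_nat (Suc k * (Suc k + 1)) * f0 (int (Suc k)) * f0 (int (Suc k) + 1)))"
    unfolding \<kappa>2 a_sums cancel b'_def[abs_def] by (rule arg_cong)
qed

section \<open>The matrix product as a random walk\<close>

definition complex_of_vec :: "real^2 \<Rightarrow> complex" where
  "complex_of_vec x = Complex (x $ 1) (x $ 2)"

lemma cmod_complex_of_vec: "cmod (complex_of_vec x) = norm x"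
  by (simp add: complex_of_vec_def cmod_def norm_vec_def L2_set_def sum_2)

lemma complex_of_vec_surj: "\<exists>x. complex_of_vec x = z"
  by (rule exI[of _ "vector [Re z, Im z]"]) (simp add: complex_of_vec_def)

lemma complex_of_vec_rotation_shear:
  "complex_of_vec (x v* rotation_shear t s) = step (t, s) (complex_of_vec x)"
  by (simp add: complex_of_vec_def rotation_shear_def step_def shear_def complex_eq_iff
      vector_matrix_mult_def matrix_matrix_mult_def sum_2 algebra_simps)

lemma complex_of_vec_matprod:
  "complex_of_vec (x v* matprod (\<lambda>j. rotation_shear (t j) (s j)) n)
    = walk (\<lambda>j. (t j, s j)) n (complex_of_vec x)"
proof (induction n arbitrary: x)
  case (Suc n)
  show ?case
    by (simp add: vector_matrix_mul_assoc[symmetric] Suc.IH complex_of_vec_rotation_shear)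
qed simp

text \<open>The blocks \<open>{Inl i, Inr i}\<close> are disjoint for different i, so functions of
  them are independent across i; the two singletons of one block give independence within a
  pair.\<close>

lemma (in prob_space) indep_vars_Plus_imp_pairs:
  assumes "indep_vars (\<lambda>_. borel) (case_sum X Y) (I <+> I)"
  shows "indep_vars (\<lambda>_. borel \<Otimes>\<^sub>M borel) (\<lambda>i \<omega>. (X i \<omega>, Y i \<omega>)) I"
    and "i \<in> I \<Longrightarrow> indep_var borel (X i) borel (Y i)"
proof -
  have "indep_vars (\<lambda>i. Pi\<^sub>M {Inl i, Inr i} (\<lambda>_. borel))
      (\<lambda>i \<omega>. restrict (\<lambda>k. case_sum X Y k \<omega>) {Inl i, Inr i}) I"
    by (rule indep_vars_restrict[OF assms]) (auto simp: disjoint_family_on_def)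
  then have "indep_vars (\<lambda>_. borel \<Otimes>\<^sub>M borel)
      (\<lambda>i \<omega>. (\<lambda>f. (f (Inl i), f (Inr i))) (restrict (\<lambda>k. case_sum X Y k \<omega>) {Inl i, Inr i})) I"
    by (rule indep_vars_compose2) (intro measurable_Pair measurable_component_singleton, auto)
  then show "indep_vars (\<lambda>_. borel \<Otimes>\<^sub>M borel) (\<lambda>i \<omega>. (X i \<omega>, Y i \<omega>)) I"
    by simp
next
  assume i: "i \<in> I"
  have "indep_var (Pi\<^sub>M {Inl i} (\<lambda>_. borel)) (\<lambda>\<omega>. restrict (\<lambda>k. case_sum X Y k \<omega>) {Inl i})
      (Pi\<^sub>M {Inr i} (\<lambda>_. borel)) (\<lambda>\<omega>. restrict (\<lambda>k. case_sum X Y k \<omega>) {Inr i})"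
    by (rule indep_var_restrict[OF assms]) (use i in auto)
  from indep_var_compose[OF this, of "\<lambda>f. f (Inl i)" borel "\<lambda>f. f (Inr i)" borel]
  show "indep_var borel (X i) borel (Y i)"
    by (simp add: o_def measurable_component_singleton)
qed

text \<open>The first n > 0 pairs of parameters have joint law \<open>walk_law n\<close>, and the
  norm of the vector moved by the product is the modulus of the walk. The Lyapunov limit is thereby
  carried over to the product space of the locale.\<close>

lemma lyapunov_imp_moment_limit:
  fixes M :: "'a measure" and t \<tau> :: "nat \<Rightarrow> 'a \<Rightarrow> real"
  assumes "prob_space M" and \<rho>: "\<rho> > 0"
    and indep: "prob_space.indep_vars M (\<lambda>_. borel) (case_sum t \<tau>) ({1..} <+> {1..})"
    and exponential: "\<And>j. j \<ge> 1 \<Longrightarrow> distributed M lborel (\<tau> j) (exponential_density \<rho>)"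
    and identical: "\<And>j. j \<ge> 1 \<Longrightarrow> distr M borel (t j) = distr M borel (t 1)"
    and l: "0 < l" "l \<le> 1/2"
    and lyapunov: "has_lyapunov_exponent M (\<lambda>j \<omega>. rotation_shear (t j \<omega>) (\<tau> j \<omega>)) (2 * l) L"
  defines "K \<equiv> distr M borel (t 1)"
  shows "rotation_shear_walk K \<rho> l"
    and "z \<noteq> 0 \<Longrightarrow> (\<lambda>n. 1 / real n *
      ln (\<integral>p. cmod (walk p n z) powr (2*l) \<partial>rotation_shear_walk.walk_law K \<rho> n)) \<longlonglongrightarrow> L"
proof -
  interpret prob_space M by fact
  have rv: "random_variable borel (t j)" "random_variable borel (\<tau> j)" if "j \<ge> 1" for j
    using indep_vars_Plus_imp_pairs(2)[OF indep, of j] that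
    by (auto dest: indep_var_rv1 indep_var_rv2)
  show W: "rotation_shear_walk K \<rho> l"
    unfolding K_def rotation_shear_walk_def using \<rho> l prob_space_distr[OF rv(1)[of 1]] by simp
  assume "z \<noteq> 0"
  interpret W: rotation_shear_walk K \<rho> l by (rule W)
  obtain x where x: "complex_of_vec x = z"
    using complex_of_vec_surj by blast
  have "x \<noteq> 0"
    using \<open>z \<noteq> 0\<close> cmod_complex_of_vec[of x] x by auto
  have pair_law: "distr M (borel \<Otimes>\<^sub>M borel) (\<lambda>\<omega>. (t j \<omega>, \<tau> j \<omega>)) = W.step_law" if "j \<ge> 1" for j
  proof -
    have "distr M borel (\<tau> j) = distr M lborel (\<tau> j)"
      by (rule distr_cong) auto
    also have "\<dots> = exponential_law \<rho>"
      by (rule distributed_distr_eq_density[OF exponential[OF that]])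
    finally have "distr M borel (\<tau> j) = exponential_law \<rho>" .
    then show ?thesis
      unfolding W.step_law_def unfolding K_def
      using indep_vars_Plus_imp_pairs(2)[OF indep, of j] that identical[OF that]
      by (simp add: indep_var_distribution_eq)
  qed
  have walk_law: "distr M (Pi\<^sub>M {1..n} (\<lambda>_. borel \<Otimes>\<^sub>M borel)) (\<lambda>\<omega>. \<lambda>j\<in>{1..n}. (t j \<omega>, \<tau> j \<omega>)) = W.walk_law n"
    if "n > 0" for n
  proof -
    have "indep_vars (\<lambda>_. borel \<Otimes>\<^sub>M borel) (\<lambda>j \<omega>. (t j \<omega>, \<tau> j \<omega>)) {1..n}"
      by (rule indep_vars_subset[OF indep_vars_Plus_imp_pairs(1)[OF indep]]) auto
    then have "distr M (Pi\<^sub>M {1..n} (\<lambda>_. borel \<Otimes>\<^sub>M borel)) (\<lambda>\<omega>. \<lambda>j\<in>{1..n}. (t j \<omega>, \<tau> j \<omega>))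
        = Pi\<^sub>M {1..n} (\<lambda>j. distr M (borel \<Otimes>\<^sub>M borel) (\<lambda>\<omega>. (t j \<omega>, \<tau> j \<omega>)))"
      using that by (subst (asm) indep_vars_iff_distr_eq_PiM') (auto intro!: measurable_Pair rv)
    also have "\<dots> = W.walk_law n"
      unfolding W.walk_law_def by (intro PiM_cong refl pair_law) auto
    finally show ?thesis .
  qed
  have "(\<integral>\<omega>. norm (x v* matprod (\<lambda>j. rotation_shear (t j \<omega>) (\<tau> j \<omega>)) n) powr (2*l) \<partial>M)
      = (\<integral>p. cmod (walk p n z) powr (2*l) \<partial>W.walk_law n)" if "n > 0" for n
  proof -
    have meas: "(\<lambda>p. cmod (walk p n z) powr (2*l)) \<in> borel_measurable (W.walk_law n)"
    proof -
      have [measurable]: "(\<lambda>p. walk p n z) \<in> borel_measurable (W.walk_law n)"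
        by (rule W.measurable_walk) auto
      show ?thesis by measurable
    qed
    have "(\<integral>p. cmod (walk p n z) powr (2*l) \<partial>W.walk_law n)
        = (\<integral>\<omega>. cmod (walk (\<lambda>j\<in>{1..n}. (t j \<omega>, \<tau> j \<omega>)) n z) powr (2*l) \<partial>M)"
      unfolding walk_law[OF that, symmetric]
    proof (rule integral_distr)
      show "(\<lambda>\<omega>. \<lambda>j\<in>{1..n}. (t j \<omega>, \<tau> j \<omega>)) \<in> M \<rightarrow>\<^sub>M Pi\<^sub>M {1..n} (\<lambda>_. borel \<Otimes>\<^sub>M borel)"
        by (intro measurable_restrict measurable_Pair rv) auto
      show "(\<lambda>p. cmod (walk p n z) powr (2*l)) \<in> borel_measurable (Pi\<^sub>M {1..n} (\<lambda>_. borel \<Otimes>\<^sub>M borel))"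
        using meas unfolding measurable_cong_sets[OF W.sets_walk_law refl] .
    qed
    also have "\<dots> = (\<integral>\<omega>. norm (x v* matprod (\<lambda>j. rotation_shear (t j \<omega>) (\<tau> j \<omega>)) n) powr (2*l) \<partial>M)"
    proof (rule Bochner_Integration.integral_cong[OF refl])
      fix \<omega>
      have "walk (\<lambda>j\<in>{1..n}. (t j \<omega>, \<tau> j \<omega>)) n z = walk (\<lambda>j. (t j \<omega>, \<tau> j \<omega>)) n z"
        by (rule walk_cong) simp
      then show "cmod (walk (\<lambda>j\<in>{1..n}. (t j \<omega>, \<tau> j \<omega>)) n z) powr (2*l)
          = norm (x v* matprod (\<lambda>j. rotation_shear (t j \<omega>) (\<tau> j \<omega>)) n) powr (2*l)"
        by (simp only: cmod_complex_of_vec[symmetric] complex_of_vec_matprod x)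
    qed
    finally show ?thesis by simp
  qed
  \<comment> \<open>At n = 0 both sides are 0, as division by zero yields 0.\<close>
  then have eq: "1 / real n * ln (\<integral>\<omega>. norm (x v* matprod (\<lambda>j. rotation_shear (t j \<omega>) (\<tau> j \<omega>)) n) powr (2*l) \<partial>M)
      = 1 / real n * ln (\<integral>p. cmod (walk p n z) powr (2*l) \<partial>W.walk_law n)" for n
    by (cases "n = 0") auto
  have "(\<lambda>n. 1 / real n * ln (\<integral>\<omega>. norm (x v* matprod (\<lambda>j. rotation_shear (t j \<omega>) (\<tau> j \<omega>)) n) powr (2*l) \<partial>M))
      \<longlonglongrightarrow> L"
    using lyapunov \<open>x \<noteq> 0\<close> unfolding has_lyapunov_exponent_def by blast
  then show "(\<lambda>n. 1 / real n * ln (\<integral>p. cmod (walk p n z) powr (2*l) \<partial>W.walk_law n)) \<longlonglongrightarrow> L"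
    unfolding eq .
qed

section \<open>The expansion of the Lyapunov exponent\<close>

lemma eventually_powser_radius:
  fixes c :: "nat \<Rightarrow> real"
  assumes "\<forall>\<^sub>F x in nhds 0. (\<lambda>k. c k * x ^ k) sums h x"
  obtains s where "0 < s" "\<And>x. norm x < s \<Longrightarrow> (\<lambda>k. c k * x ^ k) sums h x"
  using assms unfolding eventually_nhds_metric by (auto simp: dist_norm)

text \<open>Near 0, G q = - ln P(q / 2) with P the convergent power series; each differentiation
  contributes a factor 1/2 through the halved argument.\<close>

lemma deriv_neg_ln_powser:
  fixes c :: "nat \<Rightarrow> real" and G :: "real \<Rightarrow> real"
  assumes ev: "\<forall>\<^sub>F l in nhds 0. (\<lambda>k. c k * l ^ k) sums exp (- G (2 * l))" and c0: "c 0 = 1"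
  shows "deriv G 0 = - c 1 / 2" and "deriv (deriv G) 0 = (c 1)\<^sup>2 / 4 - c 2 / 2"
proof -
  obtain s where s: "0 < s" "\<And>x. norm x < s \<Longrightarrow> (\<lambda>k. c k * x ^ k) sums exp (- G (2 * x))"
    using eventually_powser_radius[OF ev] by blast
  define P where "P x = (\<Sum>n. c n * x ^ n)" for x
  define P1 where "P1 x = (\<Sum>n. diffs c n * x ^ n)" for x
  define P2 where "P2 x = (\<Sum>n. diffs (diffs c) n * x ^ n)" for x
  have summ: "summable (\<lambda>n. c n * x ^ n)" if "norm x < s" for x
    using s(2)[OF that] by (rule sums_summable)
  have summ1: "summable (\<lambda>n. diffs c n * x ^ n)" if "norm x < s" for x
    by (rule termdiff_converges[OF that summ])
  have DP: "(P has_real_derivative P1 x) (at x)" if "norm x < s" for x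
    unfolding P_def[abs_def] P1_def by (rule termdiffs_strong'[OF summ that])
  have DP1: "(P1 has_real_derivative P2 x) (at x)" if "norm x < s" for x
    unfolding P1_def[abs_def] P2_def by (rule termdiffs_strong'[OF summ1 that])
  have P_exp: "P x = exp (- G (2 * x))" if "norm x < s" for x
    unfolding P_def using s(2)[OF that] by (simp add: sums_iff)
  have at0: "P 0 = 1" "P1 0 = c 1" "P2 0 = 2 * c 2"
    by (simp_all add: P_def P1_def P2_def powser_zero c0 diffs_def numeral_2_eq_2)
  have G_eq: "G q = - ln (P (q / 2))" if "\<bar>q\<bar> < 2 * s" for q
    using P_exp[of "q / 2"] that by simp
  have P_pos: "P (q / 2) > 0" if "\<bar>q\<bar> < 2 * s" for q
    using P_exp[of "q / 2"] that by simp
  have ball: "\<forall>\<^sub>F r in nhds q. \<bar>r\<bar> < 2 * s" if "\<bar>q\<bar> < 2 * s" for q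
  proof -
    have "open {r :: real. \<bar>r\<bar> < 2 * s}"
      by (intro open_Collect_less continuous_intros)
    from eventually_nhds_in_open[OF this, of q] that show ?thesis by simp
  qed
  \<comment> \<open>The formula is established on a neighbourhood of 0, since the second derivative
    differentiates \<open>deriv G\<close> itself.\<close>
  have G': "deriv G q = - (P1 (q / 2) / 2 / P (q / 2))" if "\<bar>q\<bar> < 2 * s" for q
  proof -
    have "deriv G q = deriv (\<lambda>q. - ln (P (q / 2))) q"
      by (rule deriv_cong_ev[OF eventually_mono[OF ball[OF that] G_eq]]) auto
    also have "\<dots> = - (P1 (q / 2) / 2 / P (q / 2))"
    proof (rule DERIV_imp_deriv)
      have "((\<lambda>q. P (q / 2)) has_real_derivative P1 (q / 2) * (1 / 2)) (at q)"
        by (rule DERIV_chain2[OF DP]) (use that in \<open>auto intro!: derivative_eq_intros\<close>)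
      then show "((\<lambda>q. - ln (P (q / 2))) has_real_derivative - (P1 (q / 2) / 2 / P (q / 2))) (at q)"
        using P_pos[OF that] by (auto intro!: derivative_eq_intros)
    qed
    finally show ?thesis .
  qed
  show "deriv G 0 = - c 1 / 2"
    using G'[of 0] s(1) at0 by simp
  have "deriv (deriv G) 0 = deriv (\<lambda>q. - (P1 (q / 2) / 2 / P (q / 2))) 0"
    by (rule deriv_cong_ev[OF eventually_mono[OF ball G']]) (use s(1) in auto)
  also have "\<dots> = - ((P2 0 / 4 * P 0 - P1 0 / 2 * (P1 0 / 2)) / (P 0 * P 0))"
  proof (rule DERIV_imp_deriv)
    have "((\<lambda>q. P (q / 2)) has_real_derivative P1 (0 / 2) * (1 / 2)) (at 0)"
      "((\<lambda>q. P1 (q / 2)) has_real_derivative P2 (0 / 2) * (1 / 2)) (at 0)"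
      by (rule DERIV_chain2[OF DP] DERIV_chain2[OF DP1]; use s(1) in \<open>auto intro!: derivative_eq_intros\<close>)+
    then show "((\<lambda>q. - (P1 (q / 2) / 2 / P (q / 2))) has_real_derivative
        - ((P2 0 / 4 * P 0 - P1 0 / 2 * (P1 0 / 2)) / (P 0 * P 0))) (at 0)"
      using at0(1) by (auto intro!: derivative_eq_intros simp: field_simps)
  qed
  finally show "deriv (deriv G) 0 = (c 1)\<^sup>2 / 4 - c 2 / 2"
    by (simp add: at0 power2_eq_square)
qed

text \<open>Subtracting the leading coefficient and dividing by x shifts a power series by one
  index; each limit is the value at 0 of the shifted series.\<close>

lemma powser_quotient_limits:
  fixes c :: "nat \<Rightarrow> real"
  assumes ev: "\<forall>\<^sub>F x in nhds 0. (\<lambda>k. c k * x ^ k) sums h x"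
  shows "((\<lambda>x. (h x - c 0) / x) \<longlongrightarrow> c 1) (at 0)"
    and "((\<lambda>x. ((h x - c 0) / x - c 1) / x) \<longlongrightarrow> c 2) (at 0)"
proof -
  obtain s where s: "0 < s" "\<And>x. norm x < s \<Longrightarrow> (\<lambda>k. c k * x ^ k) sums h x"
    using eventually_powser_radius[OF ev] by blast
  have shift: "(\<lambda>k. b (Suc k) * x ^ k) sums ((y - b 0) / x)"
    if "(\<lambda>k. b k * x ^ k) sums y" "x \<noteq> 0" for b :: "nat \<Rightarrow> real" and x y
  proof -
    have "(\<lambda>k. b (Suc k) * x ^ Suc k) sums (y - b 0)"
      using that(1) by (subst sums_Suc_iff) simp
    from sums_divide[OF this, of x] show ?thesis
      using that(2) by simp
  qed
  have one: "(\<lambda>k. c (Suc k) * x ^ k) sums ((h x - c 0) / x)" if "x \<noteq> 0" "norm x < s" for x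
    using shift[OF s(2)[OF that(2)] that(1)] .
  then show "((\<lambda>x. (h x - c 0) / x) \<longlongrightarrow> c 1) (at 0)"
    using powser_limit_0_strong[OF s(1), of "\<lambda>k. c (Suc k)"] by simp
  have "(\<lambda>k. c (Suc (Suc k)) * x ^ k) sums (((h x - c 0) / x - c 1) / x)" if "x \<noteq> 0" "norm x < s" for x
    using shift[OF one[OF that] that(1)] by simp
  then show "((\<lambda>x. ((h x - c 0) / x - c 1) / x) \<longlongrightarrow> c 2) (at 0)"
    using powser_limit_0_strong[OF s(1), of "\<lambda>k. c (Suc (Suc k))"] by (simp add: numeral_2_eq_2)
qed

text \<open>The operator \<open>THE\<close> returns the limit once it is unique. The defining
  condition speaks only of nonzero vectors, so one such vector, \<open>axis 1 1\<close>, is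
  exhibited, where two candidate limits must coincide.\<close>

lemma has_lyapunov_exponent_gen_lyapunov:
  assumes "has_lyapunov_exponent M g q L"
  shows "has_lyapunov_exponent M g q (gen_lyapunov M g q)"
proof -
  have nonzero: "(axis 1 1 :: real^2) \<noteq> 0"
    by (simp add: axis_eq_0_iff)
  have "L' = L" if "has_lyapunov_exponent M g q L'" for L'
    using that assms nonzero unfolding has_lyapunov_exponent_def by (blast intro: LIMSEQ_unique)
  with assms have "gen_lyapunov M g q = L"
    unfolding gen_lyapunov_def by (rule the_equality)
  with assms show ?thesis by simp
qed

section \<open>Assembly along a sequence of exponents decreasing to 0\<close>

theorem mainTheorem1:
  fixes M :: "'a measure" and t \<tau> :: "nat \<Rightarrow> 'a \<Rightarrow> real" and \<rho> :: real
    and ch :: "real \<Rightarrow> complex" and g :: "nat \<Rightarrow> 'a \<Rightarrow> real^2^2"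
    and lam :: "nat \<Rightarrow> real" and \<nu> :: "real measure" and f0 :: "int \<Rightarrow> complex"
  assumes "prob_space M" and "\<rho> > 0"
    and indep: "prob_space.indep_vars M (\<lambda>_. borel) (case_sum t \<tau>) ({1..} <+> {1..})"
    and tau_exponential: "\<And>j. j \<ge> 1 \<Longrightarrow> distributed M lborel (\<tau> j) (exponential_density \<rho>)"
    and t_identical: "\<And>j. j \<ge> 1 \<Longrightarrow> distr M borel (t j) = distr M borel (t 1)"
    and ch_def: "ch = char (distr M borel (t 1))"
    and g_def: "\<And>j \<omega>. g j \<omega> = rotation_shear (t j \<omega>) (\<tau> j \<omega>)"
    and exponent_exists: "\<forall>\<^sub>F l in nhds 0. \<exists>L. has_lyapunov_exponent M g (2 * l) L"
    and expansion: "\<forall>\<^sub>F l in nhds 0. (\<lambda>k. lam k * l ^ k) sums exp (- gen_lyapunov M g (2 * l))"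
    and "lam 0 = 1"
    and invariant: "circle_prob \<nu>" "circle_invariant M (g 1) \<nu>"
    and invariant_unique: "\<And>\<mu>. circle_prob \<mu> \<Longrightarrow> circle_invariant M (g 1) \<mu> \<Longrightarrow> \<mu> = \<nu>"
    and f0_def: "f0 = circle_fourier \<nu>"
    and f0_solution: "dyson_schmidt_solution \<rho> ch f0"
    and f0_unique: "\<And>f. dyson_schmidt_solution \<rho> ch f \<Longrightarrow> f = f0"
  shows "growth_rate M g = - lam 1 / 2 \<and>
     growth_variance M g = (lam 1)\<^sup>2 / 4 - lam 2 / 2 \<and>
     lam 1 = 1 / \<rho> * Im (f0 1) \<and>
     summable (\<lambda>k. ch (real (Suc k)) / of_nat (Suc k) * (f0 (int (Suc k)))\<^sup>2) \<and>
     summable (\<lambda>k. 1 / of_nat (Suc k * (Suc k + 1)) * f0 (int (Suc k)) * f0 (int (Suc k) + 1)) \<and>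
     lam 2 = 1 / \<rho> * Im (f0 1
           + 2 * \<i> * complex_of_real \<rho> * complex_of_real (lam 1)
               * (\<Sum>k. ch (real (Suc k)) / of_nat (Suc k) * (f0 (int (Suc k)))\<^sup>2)
           - (\<Sum>k. 1 / of_nat (Suc k * (Suc k + 1)) * f0 (int (Suc k)) * f0 (int (Suc k) + 1)))"
proof -
  interpret prob_space M by fact
  let ?K = "distr M borel (t 1)"
  have g: "g = (\<lambda>j \<omega>. rotation_shear (t j \<omega>) (\<tau> j \<omega>))"
    by (intro ext g_def)
  have "t 1 \<in> borel_measurable M"
    using indep_vars_Plus_imp_pairs(2)[OF indep, of 1] by (auto dest: indep_var_rv1)
  then interpret K: real_distribution ?K
    by (rule real_distribution_distr)
  define h where "h l = exp (- gen_lyapunov M g (2 * l))" for l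
  obtain d where d: "0 < d" "\<And>l. \<bar>l\<bar> < d \<Longrightarrow> \<exists>L. has_lyapunov_exponent M g (2 * l) L"
    using exponent_exists unfolding eventually_nhds_metric by (auto simp: dist_norm)
  \<comment> \<open>Positive and at most 1/2, as the walk locale demands, and below
    \<open>d\<close>, so that the exponent exists at \<open>2 * ls j\<close>.\<close>
  define ls where "ls j = min (d / 2) (1/2) / real (Suc j)" for j
  have ls: "0 < ls j" "ls j \<le> 1/2" "ls j < d" for j
  proof -
    show "0 < ls j" using d(1) by (simp add: ls_def)
    have "ls j \<le> min (d / 2) (1/2) / 1"
      unfolding ls_def using d(1) by (intro divide_left_mono) auto
    then show "ls j \<le> 1/2" "ls j < d" using d(1) by auto
  qed
  have ls_lim: "ls \<longlonglongrightarrow> 0"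
    unfolding ls_def by (intro tendsto_divide_0[OF tendsto_const] filterlim_at_top_imp_at_infinity
      filterlim_compose[OF filterlim_real_sequentially filterlim_Suc])
  \<comment> \<open>The perturbed equation is taken with precision \<epsilon> =
    \<open>ls j ^ 3\<close>, so that replacing \<open>h (ls j)\<close> by \<open>R j\<close> leaves
    the expansion unchanged up to second order.\<close>
  define Q where "Q j r f \<eta> \<longleftrightarrow> \<bar>r - h (ls j)\<bar> < ls j ^ 3 \<and> f 0 = 1 \<and> (\<forall>k. cmod (f k) \<le> 1)
      \<and> (\<forall>k. f (- k) = cnj (f k)) \<and> (\<forall>k. cmod (\<eta> k) \<le> ls j ^ 3)
      \<and> (\<forall>k. f k + \<i> / (2 * of_real \<rho>) * ((of_int k - of_real (ls j)) * f (k + 1)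
        + 2 * of_int k * f k + (of_int k + of_real (ls j)) * f (k - 1))
        = of_real r * ch (of_int k) * (f k + \<eta> k))" for j r and f \<eta> :: "int \<Rightarrow> complex"
  have "\<exists>r f \<eta>. Q j r f \<eta>" for j
  proof -
    obtain L where "has_lyapunov_exponent M g (2 * ls j) L"
      using d(2)[of "ls j"] ls[of j] by auto
    then have "has_lyapunov_exponent M (\<lambda>j \<omega>. rotation_shear (t j \<omega>) (\<tau> j \<omega>)) (2 * ls j)
        (gen_lyapunov M g (2 * ls j))"
      using has_lyapunov_exponent_gen_lyapunov unfolding g by blast
    note walk = lyapunov_imp_moment_limit[OF assms(1,2) indep _ _ ls(1,2) this]
    interpret W: rotation_shear_walk ?K \<rho> "ls j"
      by (rule walk(1)) (rule tau_exponential t_identical, assumption)+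
    have "(\<lambda>n. 1 / real n * ln (W.moment n z)) \<longlonglongrightarrow> gen_lyapunov M g (2 * ls j)" if "z \<noteq> 0" for z
      unfolding W.moment_def using that
      by (intro walk(2)) (rule tau_exponential t_identical, assumption)+
    moreover have "0 < ls j ^ 3" using ls(1)[of j] by simp
    ultimately show ?thesis
      unfolding Q_def h_def ch_def by (rule W.perturbed_dyson_schmidt)
  qed
  then obtain R F E where Q: "\<And>j. Q j (R j) (F j) (E j)"
    by metis
  have ls_at: "filterlim ls (at 0) sequentially"
    using ls_lim ls(1) by (auto simp: filterlim_at less_imp_neq[symmetric] intro!: always_eventually)
  have h_ev: "\<forall>\<^sub>F l in nhds 0. (\<lambda>k. lam k * l ^ k) sums h l"
    using expansion by (simp add: h_def)
  have err: "(\<lambda>j. (R j - h (ls j)) / ls j / ls j) \<longlonglongrightarrow> 0"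
  proof (rule Lim_null_comparison[OF always_eventually[OF allI] ls_lim])
    fix j
    have "\<bar>R j - h (ls j)\<bar> \<le> ls j * ls j * ls j"
      using Q[of j] by (simp add: Q_def power3_eq_cube)
    then show "norm ((R j - h (ls j)) / ls j / ls j) \<le> ls j"
      using ls(1)[of j] by (simp add: pos_divide_le_eq mult.assoc)
  qed
  have h1: "(\<lambda>j. (h (ls j) - lam 0) / ls j) \<longlonglongrightarrow> lam 1"
    by (rule filterlim_compose[OF powser_quotient_limits(1)[OF h_ev] ls_at])
  have h2: "(\<lambda>j. ((h (ls j) - lam 0) / ls j - lam 1) / ls j) \<longlonglongrightarrow> lam 2"
    by (rule filterlim_compose[OF powser_quotient_limits(2)[OF h_ev] ls_at])
  \<comment> \<open>The error of the first quotient is written as \<open>ls j\<close> times the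
    doubly divided one, which \<open>err\<close> controls.\<close>
  have "(\<lambda>j. (h (ls j) - lam 0) / ls j + ls j * ((R j - h (ls j)) / ls j / ls j)) \<longlonglongrightarrow> lam 1 + 0 * 0"
    by (intro tendsto_intros h1 ls_lim err)
  moreover have "(h (ls j) - lam 0) / ls j + ls j * ((R j - h (ls j)) / ls j / ls j) = (R j - 1) / ls j" for j
  proof -
    have cancel: "ls j * ((R j - h (ls j)) / ls j / ls j) = (R j - h (ls j)) / ls j"
      using ls(1)[of j] by simp
    show ?thesis
      unfolding cancel \<open>lam 0 = 1\<close> by (simp add: diff_divide_distrib)
  qed
  ultimately have R1: "(\<lambda>j. (R j - 1) / ls j) \<longlonglongrightarrow> lam 1"
    by simp
  have "(\<lambda>j. ((h (ls j) - lam 0) / ls j - lam 1) / ls j + (R j - h (ls j)) / ls j / ls j) \<longlonglongrightarrow> lam 2 + 0"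
    by (intro tendsto_add h2 err)
  moreover have "((h (ls j) - lam 0) / ls j - lam 1) / ls j + (R j - h (ls j)) / ls j / ls j
      = ((R j - 1) / ls j - lam 1) / ls j" for j
    using \<open>lam 0 = 1\<close> by (simp add: diff_divide_distrib)
  ultimately have R2: "(\<lambda>j. ((R j - 1) / ls j - lam 1) / ls j) \<longlonglongrightarrow> lam 2"
    by simp
  have chb: "cmod (ch x) \<le> 1" "ch 0 = 1" for x
    unfolding ch_def by (rule K.cmod_char_le_1 K.char_zero)+
  note Q' = Q[unfolded Q_def, THEN conjunct2]
  note F = Q'[THEN conjunct1] Q'[THEN conjunct2, THEN conjunct1, rule_format]
    Q'[THEN conjunct2, THEN conjunct2, THEN conjunct1, rule_format]
    Q'[THEN conjunct2, THEN conjunct2, THEN conjunct2, THEN conjunct1, rule_format]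
    Q'[THEN conjunct2, THEN conjunct2, THEN conjunct2, THEN conjunct2, rule_format]
  note expansion2 = second_order_expansion[OF assms(2) f0_solution chb ls(1,2) ls_lim R1 R2 F]
  show ?thesis
    unfolding growth_rate_def growth_variance_def
    by (intro conjI deriv_neg_ln_powser[where G = "gen_lyapunov M g", OF expansion \<open>lam 0 = 1\<close>] expansion2)
qed

end
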